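(* Let $n\ge 3$ and $d\ge 1$ be integers and let $\overline{\sigma}=\{\sigma_1,\ldots,\sigma_n\}$ be a collection of $n$ integer partitions of $d$. Then the space $\mathcal{H}(\overline{\sigma})$ (defined in the context) is a polyhedral complex, in the sense of the definition given in the context.
   Context: **Graphs.** A graph is a pair $(V,E)$ with $V$ a finite set and $E$ a set of unordered pairs of elements of $V$. A tree is a connected graph without circuits. A leaf is a vertex of degree $1$; other vertices are internal. An edge containing a leaf is unbounded; other edges are bounded. A graph is trivalent if all vertices have degree $1$ or $3$. A trivalent tree with $n\ge 3$ leaves has $m=n-3$ bounded edges. An isomorphism of graphs is a bijection $F_V$ of vertices inducing a bijection $F_E$ of edges; the topological type of a graph is its isomorphism class. The degeneration of $G$ by a bounded edge $e$ is the graph obtained by contracting $e$ to a point (identifying its endpoints and deleting $e$). **Class algebra.** For an integer partition $\mu$ of $d$, $K_\mu\in Z(\mathbb{R}[S_d])$ is the sum of all permutations in $S_d$ of cycle-type $\mu$. The function $\mathrm{tr}:Z(\mathbb{R}[S_d])\to\mathbb{R}$ is $\mathrm{tr}(\sum_g c_g g)=c_e$, the coefficient of the identity. **Labelled trees.** Let $G$ be a topological type of trivalent trees with $n$ leaves, with its unbounded edges (equivalently its leaves) labelled by the distinct elements of $\overline{\lambda}=\{\lambda_1,\ldots,\lambda_n\}$ and its bounded edges labelled by the distinct elements of $\overline{E}=\{e_1,\ldots,e_m\}$. Assign $\sigma_i$ to $\lambda_i$, and let $\overline{\nu}=\{\nu_1,\ldots,\nu_m\}$ be a choice of an integer partition $\nu_i$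 of $d$ for each $e_i$. This data is denoted $G(\overline{\sigma},\overline{\nu})$. It is acceptable if for every internal vertex $v$, $\mathrm{tr}(K_{\mu_1}K_{\mu_2}K_{\mu_3})\ne 0$, where $\mu_1,\mu_2,\mu_3$ are the partitions assigned to the three edges at $v$. For $p=(p_1,\ldots,p_m)\in\mathbb{R}^m_{\ge 0}$, $G(\overline{\lambda},\overline{E})(p)$ is the labelled metric graph obtained from $G$ by degenerating every $e_i$ with $p_i=0$ and giving length $p_i$ to each $e_i$ with $p_i>0$; the labels of the surviving edges are kept. **The space.** $D(\overline{\sigma})$ is the disjoint union of copies $D(\overline{\sigma})_{G(\overline{\sigma},\overline{\nu})}$ of $\mathbb{R}^m_{\ge 0}$ (with the Euclidean topology), indexed by the possible choices of acceptable $G(\overline{\sigma},\overline{\nu})$ ($\overline{\sigma}$ is fixed; the labelled trivalent tree and $\overline{\nu}$ vary). $\mathcal{H}(\overline{\sigma})$ is the topological space formed from $D(\overline{\sigma})$ by identifying $p\in D(\overline{\sigma})_{G(\overline{\sigma},\overline{\nu})}$ and $q\in D(\overline{\sigma})_{G'(\overline{\sigma},\overline{\nu}')}$ exactly when there is an isomorphism of metric graphs (a graph isomorphism preserving lengths of bounded edges) $F:G(\overline{\lambda},\overline{E})(p)\to G'(\overline{\lambda},\overline{E})(q)$ such that $F_E(\lambda_i)=\lambda_i$ for all $i$, and $F_E(e_i)=e_j$ implies $\nu_i=\nu'_j$. **Polyhedral complexes.** A chart for a closed subset $P$ of a topological space $C$ is a homeomorphism $c:X\to P$ with $X$ a closed,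 possibly unbounded, lattice polyhedron in some $\mathbb{R}^j$. Let $V_X$ be the smallest affine space containing $X$. Charts $c_X:X\to P$, $c_Y:Y\to P$ ($X\subset\mathbb{R}^j$, $Y\subset\mathbb{R}^k$) are lattice-equivalent if there is an isomorphism of affine spaces $f:V_X\to V_Y$ with $f(X)=Y$ and $c_X=c_Y\circ f$, which restricts to an affine isomorphism of $V_X\cap\mathbb{Z}^j$ with $V_Y\cap\mathbb{Z}^k$. A polyhedral complex is a topological space $C$, together with a collection of closed cells $\{P_i\mid i\in I\}$ and for each $i$ a lattice-equivalence class of charts $c_i:X_i\to P_i$, for some closed lattice polyhedra $X_i$, such that: $C$ is the union of the $P_i$; for each $i,j\in I$ the intersection $P_i\cap P_j$ equals $P_k$ for some $k\in I$; if $Y$ is a face of $X_i$ then there is $j$ with $c_i(Y)=P_j$; and if two charts $c_i:X_i\to P$ and $c_j:X_j\to P$ have the same image $P_i=P=P_j$, then they are lattice-equivalent. *)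

theory Defs
  imports
    "HOL-Analysis.Analysis"
    "HOL-Library.Function_Algebras"
    "HOL-Library.Multiset"
    "HOL-Combinatorics.Permutations"
    "HOL-Combinatorics.Orbits"
begin

section \<open>Lattice polyhedra and polyhedral complexes\<close>

text \<open>Since the dimension of the domain of a chart varies, \<open>\<real>\<^sup>j\<close> is the library's
  \<^const>\<open>Euclidean_space\<close>, a topology on the functions \<open>nat \<Rightarrow> real\<close> that vanish from \<open>j\<close> on.
  The pointwise vector space structure on functions makes the library notions of convex, conic and
  affine hulls and of faces available there.\<close>

instantiation "fun" :: (type, real_vector) real_vector
begin

definition scaleR_fun :: "real \<Rightarrow> ('a \<Rightarrow> 'b) \<Rightarrow> 'a \<Rightarrow> 'b"
  where "scaleR_fun r f = (\<lambda>x. r *\<^sub>R f x)"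

instance
  by standard (auto simp: scaleR_fun_def fun_eq_iff scaleR_add_right scaleR_add_left)

end

definition int_lattice :: "nat \<Rightarrow> (nat \<Rightarrow> real) set"
  where "int_lattice j = {x \<in> topspace (Euclidean_space j). \<forall>i<j. x i \<in> \<int>}"

text \<open>The convex hull of finitely many lattice points plus the cone spanned by finitely many
  lattice vectors. Such a set is automatically closed; it is unbounded iff the cone is nonzero, and
  it is empty iff there are no points.\<close>

definition lattice_polyhedron :: "nat \<Rightarrow> (nat \<Rightarrow> real) set \<Rightarrow> bool"
  where "lattice_polyhedron j X \<longleftrightarrow>
    (\<exists>A R. finite A \<and> A \<subseteq> int_lattice j \<and> finite R \<and> R \<subseteq> int_lattice j \<and>
           X = {a + r |a r. a \<in> convex hull A \<and> r \<in> convex_cone hull R})"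

record 'a chart =
  chart_dim :: nat
  chart_dom :: "(nat \<Rightarrow> real) set"
  chart_map :: "(nat \<Rightarrow> real) \<Rightarrow> 'a"

definition chart_for :: "'a topology \<Rightarrow> 'a set \<Rightarrow> 'a chart \<Rightarrow> bool"
  where "chart_for C P c \<longleftrightarrow>
    closedin C P \<and>
    lattice_polyhedron (chart_dim c) (chart_dom c) \<and>
    homeomorphic_map (subtopology (Euclidean_space (chart_dim c)) (chart_dom c))
                     (subtopology C P) (chart_map c)"

text \<open>An isomorphism of affine spaces is a bijection preserving affine combinations.\<close>

definition affine_iso ::
    "('a::real_vector \<Rightarrow> 'b::real_vector) \<Rightarrow> 'a set \<Rightarrow> 'b set \<Rightarrow> bool"
  where "affine_iso f V W \<longleftrightarrow>
    bij_betw f V W \<and>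
    (\<forall>x\<in>V. \<forall>y\<in>V. \<forall>t. f ((1 - t) *\<^sub>R x + t *\<^sub>R y) = (1 - t) *\<^sub>R f x + t *\<^sub>R f y)"

definition lattice_equivalent :: "'a chart \<Rightarrow> 'a chart \<Rightarrow> bool"
  where "lattice_equivalent c c' \<longleftrightarrow>
    (\<exists>f. affine_iso f (affine hull chart_dom c) (affine hull chart_dom c') \<and>
         f ` chart_dom c = chart_dom c' \<and>
         (\<forall>x\<in>chart_dom c. chart_map c x = chart_map c' (f x)) \<and>
         f ` (affine hull chart_dom c \<inter> int_lattice (chart_dim c)) =
           affine hull chart_dom c' \<inter> int_lattice (chart_dim c'))"

definition lattice_equivalence_on :: "'a topology \<Rightarrow> 'a set \<Rightarrow> ('a chart \<times> 'a chart) set"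
  where "lattice_equivalence_on C P =
    {(c, c'). chart_for C P c \<and> chart_for C P c' \<and> lattice_equivalent c c'}"

definition polyhedral_complex ::
    "'a topology \<Rightarrow> 'i set \<Rightarrow> ('i \<Rightarrow> 'a set) \<Rightarrow> ('i \<Rightarrow> 'a chart set) \<Rightarrow> bool"
  where "polyhedral_complex C I P charts \<longleftrightarrow>
    (\<forall>i\<in>I. closedin C (P i)) \<and>
    (\<forall>i\<in>I. charts i \<in> {c. chart_for C (P i) c} // lattice_equivalence_on C (P i)) \<and>
    topspace C = (\<Union>i\<in>I. P i) \<and>
    (\<forall>i\<in>I. \<forall>j\<in>I. \<exists>k\<in>I. P i \<inter> P j = P k) \<and>
    (\<forall>i\<in>I. \<forall>c\<in>charts i. \<forall>Y. Y face_of chart_dom c \<longrightarrow> (\<exists>j\<in>I. chart_map c ` Y = P j)) \<and>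
    (\<forall>i\<in>I. \<forall>j\<in>I. P i = P j \<longrightarrow>
       (\<forall>c\<in>charts i. \<forall>c'\<in>charts j. lattice_equivalent c c'))"


section \<open>Quotient spaces\<close>

definition quotient_topology :: "'a topology \<Rightarrow> ('a \<times> 'a) set \<Rightarrow> 'a set topology"
  where "quotient_topology X r =
    topology (\<lambda>U. U \<subseteq> topspace X // r \<and> openin X {x \<in> topspace X. r `` {x} \<in> U})"

lemma istopology_quotient:
  "istopology (\<lambda>U. U \<subseteq> topspace X // r \<and> openin X {x \<in> topspace X. r `` {x} \<in> U})"
proof -
  have 1: "{x \<in> topspace X. r `` {x} \<in> S \<inter> T} =
      {x \<in> topspace X. r `` {x} \<in> S} \<inter> {x \<in> topspace X. r `` {x} \<in> T}" for S T
    by auto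
  have 2: "{x \<in> topspace X. r `` {x} \<in> \<Union> \<K>} =
      (\<Union>K\<in>\<K>. {x \<in> topspace X. r `` {x} \<in> K})" for \<K>
    by auto
  show ?thesis
    unfolding istopology_def 1 2 by blast
qed

lemma openin_quotient_topology:
  "openin (quotient_topology X r) U \<longleftrightarrow>
     U \<subseteq> topspace X // r \<and> openin X {x \<in> topspace X. r `` {x} \<in> U}"
  by (simp add: quotient_topology_def istopology_quotient)


section \<open>Integer partitions and the class algebra\<close>

definition integer_partition :: "nat \<Rightarrow> nat multiset \<Rightarrow> bool"
  where "integer_partition d \<mu> \<longleftrightarrow> sum_mset \<mu> = d \<and> 0 \<notin># \<mu>"

text \<open>\<open>S\<^sub>d\<close> consists of the \<open>\<pi>\<close> with \<open>\<pi> permutes {1..d}\<close>. Fixed points count as cycles of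
  length one.\<close>

definition cycle_type :: "nat \<Rightarrow> (nat \<Rightarrow> nat) \<Rightarrow> nat multiset"
  where "cycle_type d \<pi> = image_mset card (mset_set (orbit \<pi> ` {1..d}))"

text \<open>An element of \<open>\<real>[S\<^sub>d]\<close> is its coefficient function.\<close>

definition class_sum :: "nat \<Rightarrow> nat multiset \<Rightarrow> (nat \<Rightarrow> nat) \<Rightarrow> real"
  where "class_sum d \<mu> = (\<lambda>\<pi>. if \<pi> permutes {1..d} \<and> cycle_type d \<pi> = \<mu> then 1 else 0)"

definition ga_mult ::
    "nat \<Rightarrow> ((nat \<Rightarrow> nat) \<Rightarrow> real) \<Rightarrow> ((nat \<Rightarrow> nat) \<Rightarrow> real) \<Rightarrow> (nat \<Rightarrow> nat) \<Rightarrow> real"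
  where "ga_mult d a b =
    (\<lambda>g. \<Sum>(h, k) \<in> {(h, k). h permutes {1..d} \<and> k permutes {1..d} \<and> h \<circ> k = g}. a h * b k)"

definition ga_trace :: "((nat \<Rightarrow> nat) \<Rightarrow> real) \<Rightarrow> real"
  where "ga_trace a = a id"


section \<open>Graphs\<close>

type_synonym 'v graph = "'v set \<times> 'v set set"

definition is_graph :: "'v graph \<Rightarrow> bool"
  where "is_graph G \<longleftrightarrow> finite (fst G) \<and>
    (\<forall>e\<in>snd G. \<exists>u\<in>fst G. \<exists>v\<in>fst G. u \<noteq> v \<and> e = {u, v})"

definition adjacent :: "'v set set \<Rightarrow> ('v \<times> 'v) set"
  where "adjacent E = {(u, v). {u, v} \<in> E}"

definition connected_graph :: "'v graph \<Rightarrow> bool"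
  where "connected_graph G \<longleftrightarrow> fst G \<noteq> {} \<and>
    (\<forall>u\<in>fst G. \<forall>v\<in>fst G. (u, v) \<in> (adjacent (snd G))\<^sup>*)"

definition circuit :: "'v graph \<Rightarrow> 'v list \<Rightarrow> bool"
  where "circuit G vs \<longleftrightarrow> 3 \<le> length vs \<and> distinct vs \<and> set vs \<subseteq> fst G \<and>
    (\<forall>i<length vs. {vs ! i, vs ! (Suc i mod length vs)} \<in> snd G)"

definition tree_graph :: "'v graph \<Rightarrow> bool"
  where "tree_graph G \<longleftrightarrow> is_graph G \<and> connected_graph G \<and> (\<nexists>vs. circuit G vs)"

definition edges_at :: "'v graph \<Rightarrow> 'v \<Rightarrow> 'v set set"
  where "edges_at G v = {e \<in> snd G. v \<in> e}"

definition degree :: "'v graph \<Rightarrow> 'v \<Rightarrow> nat"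
  where "degree G v = card (edges_at G v)"

definition leaves :: "'v graph \<Rightarrow> 'v set"
  where "leaves G = {v \<in> fst G. degree G v = 1}"

definition unbounded_edges :: "'v graph \<Rightarrow> 'v set set"
  where "unbounded_edges G = {e \<in> snd G. e \<inter> leaves G \<noteq> {}}"

definition bounded_edges :: "'v graph \<Rightarrow> 'v set set"
  where "bounded_edges G = {e \<in> snd G. e \<inter> leaves G = {}}"

definition trivalent :: "'v graph \<Rightarrow> bool"
  where "trivalent G \<longleftrightarrow> (\<forall>v\<in>fst G. degree G v = 1 \<or> degree G v = 3)"

definition graph_iso :: "('v \<Rightarrow> 'w) \<Rightarrow> 'v graph \<Rightarrow> 'w graph \<Rightarrow> bool"
  where "graph_iso F G G' \<longleftrightarrow>
    bij_betw F (fst G) (fst G') \<and> bij_betw (image F) (snd G) (snd G')"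

text \<open>Contracting a set \<open>S\<close> of edges sends a vertex to the set of all vertices it gets identified
  with.\<close>

definition contract_vertex :: "'v set set \<Rightarrow> 'v \<Rightarrow> 'v set"
  where "contract_vertex S v = {w. (v, w) \<in> (adjacent S)\<^sup>*}"

definition contract :: "'v set set \<Rightarrow> 'v graph \<Rightarrow> 'v set graph"
  where "contract S G =
    (contract_vertex S ` fst G, (\<lambda>e. contract_vertex S ` e) ` (snd G - S))"


section \<open>Labelled trees\<close>

text \<open>Indices start at 0: \<open>lam T i\<close> is the unbounded edge labelled \<open>\<lambda>\<^bsub>i+1\<^esub>\<close>, for \<open>i < n\<close>, and
  \<open>bnd T i\<close> is the bounded edge labelled \<open>e\<^bsub>i+1\<^esub>\<close>, for \<open>i < n - 3\<close>. Other values are irrelevant.\<close>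

record 'v labelled_graph =
  gr :: "'v graph"
  lam :: "nat \<Rightarrow> 'v set"
  bnd :: "nat \<Rightarrow> 'v set"

definition labelled_tree :: "nat \<Rightarrow> nat labelled_graph \<Rightarrow> bool"
  where "labelled_tree n T \<longleftrightarrow>
    tree_graph (gr T) \<and> trivalent (gr T) \<and> card (leaves (gr T)) = n \<and>
    bij_betw (lam T) {..<n} (unbounded_edges (gr T)) \<and>
    bij_betw (bnd T) {..<n - 3} (bounded_edges (gr T))"

definition labelled_iso_rel :: "nat \<Rightarrow> (nat labelled_graph \<times> nat labelled_graph) set"
  where "labelled_iso_rel n =
    {(T, T'). labelled_tree n T \<and> labelled_tree n T' \<and>
       (\<exists>F. graph_iso F (gr T) (gr T') \<and>
            (\<forall>i<n. F ` lam T i = lam T' i) \<and> (\<forall>i<n - 3. F ` bnd T i = bnd T' i))}"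

text \<open>Every finite graph is isomorphic to one whose vertices are natural numbers, so these are all
  the topological types of labelled trivalent trees with \<open>n\<close> leaves.\<close>

definition labelled_types :: "nat \<Rightarrow> nat labelled_graph set set"
  where "labelled_types n = {T. labelled_tree n T} // labelled_iso_rel n"

definition edge_partition ::
    "nat \<Rightarrow> (nat \<Rightarrow> nat multiset) \<Rightarrow> (nat \<Rightarrow> nat multiset) \<Rightarrow> nat labelled_graph \<Rightarrow>
     nat set \<Rightarrow> nat multiset \<Rightarrow> bool"
  where "edge_partition n \<sigma> \<nu> T e \<mu> \<longleftrightarrow>
    (\<exists>i<n. e = lam T i \<and> \<mu> = \<sigma> i) \<or> (\<exists>i<n - 3. e = bnd T i \<and> \<mu> = \<nu> i)"

definition acceptable_tree ::
    "nat \<Rightarrow> nat \<Rightarrow> (nat \<Rightarrow> nat multiset) \<Rightarrow> (nat \<Rightarrow> nat multiset) \<Rightarrow> nat labelled_graph \<Rightarrow> bool"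
  where "acceptable_tree d n \<sigma> \<nu> T \<longleftrightarrow>
    (\<forall>v \<in> fst (gr T) - leaves (gr T). \<forall>e1 e2 e3 \<mu>1 \<mu>2 \<mu>3.
       edges_at (gr T) v = {e1, e2, e3} \<and> distinct [e1, e2, e3] \<and>
       edge_partition n \<sigma> \<nu> T e1 \<mu>1 \<and>
       edge_partition n \<sigma> \<nu> T e2 \<mu>2 \<and>
       edge_partition n \<sigma> \<nu> T e3 \<mu>3 \<longrightarrow>
       ga_trace (ga_mult d (ga_mult d (class_sum d \<mu>1) (class_sum d \<mu>2)) (class_sum d \<mu>3)) \<noteq> 0)"

text \<open>The acceptable \<open>G(\<sigma>,\<nu>)\<close>: pairs of a labelled type and a choice of \<open>\<nu>\<close>. Acceptability does
  not depend on the representative \<open>T\<close>.\<close>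

definition acceptable_data ::
    "nat \<Rightarrow> nat \<Rightarrow> (nat \<Rightarrow> nat multiset) \<Rightarrow> (nat labelled_graph set \<times> (nat \<Rightarrow> nat multiset)) set"
  where "acceptable_data d n \<sigma> =
    {(G, \<nu>). G \<in> labelled_types n \<and> \<nu> \<in> {..<n - 3} \<rightarrow>\<^sub>E {\<mu>. integer_partition d \<mu>} \<and>
             (\<forall>T\<in>G. acceptable_tree d n \<sigma> \<nu> T)}"


section \<open>Metric trees and the space \<open>H\<close>\<close>

text \<open>\<open>surv\<close> is the set of indices of the bounded edges that have survived, and \<open>len i\<close> is the
  length of the edge \<open>bnd i\<close>.\<close>

record 'v metric_graph = "'v labelled_graph" +
  surv :: "nat set"
  len :: "nat \<Rightarrow> real"

definition degenerate ::
    "nat \<Rightarrow> nat labelled_graph \<Rightarrow> (nat \<Rightarrow> real) \<Rightarrow> nat set metric_graph"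
  where "degenerate n T p =
    (let S = bnd T ` {i. i < n - 3 \<and> p i = 0} in
     \<lparr>gr = contract S (gr T),
      lam = (\<lambda>i. contract_vertex S ` lam T i),
      bnd = (\<lambda>i. contract_vertex S ` bnd T i),
      surv = {i. i < n - 3 \<and> p i > 0},
      len = p\<rparr>)"

definition metric_iso ::
    "('v \<Rightarrow> 'w) \<Rightarrow> 'v metric_graph \<Rightarrow> 'w metric_graph \<Rightarrow> bool"
  where "metric_iso F M M' \<longleftrightarrow>
    graph_iso F (gr M) (gr M') \<and>
    (\<forall>i\<in>surv M. \<forall>j\<in>surv M'. F ` bnd M i = bnd M' j \<longrightarrow> len M i = len M' j)"

definition orthant :: "nat \<Rightarrow> (nat \<Rightarrow> real) set"
  where "orthant m = {x \<in> topspace (Euclidean_space m). \<forall>i<m. 0 \<le> x i}"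

type_synonym D_point =
  "(nat labelled_graph set \<times> (nat \<Rightarrow> nat multiset)) \<times> (nat \<Rightarrow> real)"

definition D_space :: "nat \<Rightarrow> nat \<Rightarrow> (nat \<Rightarrow> nat multiset) \<Rightarrow> D_point topology"
  where "D_space d n \<sigma> =
    sum_topology (\<lambda>_. subtopology (Euclidean_space (n - 3)) (orthant (n - 3)))
                 (acceptable_data d n \<sigma>)"

text \<open>Whether two points are identified does not depend on the representatives \<open>T\<close>, \<open>T'\<close>.\<close>

definition identified :: "nat \<Rightarrow> nat \<Rightarrow> (nat \<Rightarrow> nat multiset) \<Rightarrow> (D_point \<times> D_point) set"
  where "identified d n \<sigma> =
    {(((G, \<nu>), p), ((G', \<nu>'), q)).
       ((G, \<nu>), p) \<in> topspace (D_space d n \<sigma>) \<and> ((G', \<nu>'), q) \<in> topspace (D_space d n \<sigma>) \<and>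
       (\<exists>T\<in>G. \<exists>T'\<in>G'. \<exists>F.
          let M = degenerate n T p; M' = degenerate n T' q in
          metric_iso F M M' \<and>
          (\<forall>i<n. F ` lam M i = lam M' i) \<and>
          (\<forall>i\<in>surv M. \<forall>j\<in>surv M'. F ` bnd M i = bnd M' j \<longrightarrow> \<nu> i = \<nu>' j))}"

definition H_space :: "nat \<Rightarrow> nat \<Rightarrow> (nat \<Rightarrow> nat multiset) \<Rightarrow> D_point set topology"
  where "H_space d n \<sigma> = quotient_topology (D_space d n \<sigma>) (identified d n \<sigma>)"

definition H_proj :: "nat \<Rightarrow> nat \<Rightarrow> (nat \<Rightarrow> nat multiset) \<Rightarrow> D_point \<Rightarrow> D_point set"
  where "H_proj d n \<sigma> x = identified d n \<sigma> `` {x}"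

text \<open>The cell structure of \<open>H\<close>: the cells are the images of the faces \<open>Y\<close> of the orthants of
  \<open>D\<close> (the orthants themselves included), charted by the quotient map. As usual for polyhedral
  complexes, the empty set is a face of every polyhedron, in agreement with \<open>face_of\<close>.
  The structure has to be named: with freely chosen cells, the definition of a polyhedral complex
  is met by every T1 space, using as cells its points and the empty set.\<close>

type_synonym H_index =
  "(nat labelled_graph set \<times> (nat \<Rightarrow> nat multiset)) \<times> (nat \<Rightarrow> real) set"

definition H_index :: "nat \<Rightarrow> nat \<Rightarrow> (nat \<Rightarrow> nat multiset) \<Rightarrow> H_index set"
  where "H_index d n \<sigma> = {(g, Y). g \<in> acceptable_data d n \<sigma> \<and> Y face_of orthant (n - 3)}"

definition H_cell :: "nat \<Rightarrow> nat \<Rightarrow> (nat \<Rightarrow> nat multiset) \<Rightarrow> H_index \<Rightarrow> D_point set set"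
  where "H_cell d n \<sigma> = (\<lambda>(g, Y). (\<lambda>p. H_proj d n \<sigma> (g, p)) ` Y)"

definition H_chart :: "nat \<Rightarrow> nat \<Rightarrow> (nat \<Rightarrow> nat multiset) \<Rightarrow> H_index \<Rightarrow> D_point set chart"
  where "H_chart d n \<sigma> = (\<lambda>(g, Y).
    \<lparr>chart_dim = n - 3, chart_dom = Y, chart_map = (\<lambda>p. H_proj d n \<sigma> (g, p))\<rparr>)"

definition H_charts :: "nat \<Rightarrow> nat \<Rightarrow> (nat \<Rightarrow> nat multiset) \<Rightarrow> H_index \<Rightarrow> D_point set chart set"
  where "H_charts d n \<sigma> i =
    lattice_equivalence_on (H_space d n \<sigma>) (H_cell d n \<sigma> i) `` {H_chart d n \<sigma> i}"

end

theory Submission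
  imports Defs
begin

text \<open>Root every labelled tree at its first leaf and attach to each edge its cluster, the set of
  the labels of the leaves that the edge separates from the root. Since internal vertices have degree
  three, distinct edges have distinct clusters, and a contracted tree is determined up to
  isomorphism by the clusters of its surviving edges. Hence two points of \<open>D\<close> are identified iff
  they have the same set of triples (cluster, partition, length) of edges of positive length.

  For two given orthants, matching the coordinates with equal cluster and partition therefore
  identifies a coordinate face of the one with a coordinate face of the other, and nothing else is
  identified. So \<open>\<H>\<close> is obtained by gluing orthants along single faces: the quotient map is
  closed and injective on each orthant, and cells meet in a common face.\<close>

section \<open>Trees\<close>

text \<open>The relation \<open>identified\<close> asks for an isomorphism between contractions of
  representatives, from which neither its transitivity nor the shape of its classes can be seen.
  Equality of an invariant settles both and turns every question on cells into one on nonnegative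
  vectors with labelled coordinates. The index of a bounded edge cannot enter the invariant, since
  an isomorphism may send \<open>e_i\<close> to \<open>e_j\<close>; a coordinate is named by its
  cluster and partition instead. Clusters are distinct within one tree, so two trees match
  coordinates by a partial bijection, which extends by 0 to a linear map. This one map yields
  closedness of the cells, their intersections and the lattice equivalences. An edge splits the
  labels into two parts, and the root selects one of them consistently, so that inclusion of
  clusters encodes the shape of the tree. Since isomorphisms are only constrained on labelled edges,
  not on leaves, clusters occur in two forms: by leaves for work inside a tree, and by pendant edges
  for comparing trees.\<close>

lemma sym_rtrancl_adjacent: "(u, v) \<in> (adjacent E)\<^sup>* \<Longrightarrow> (v, u) \<in> (adjacent E)\<^sup>*"
proof -
  have "sym (adjacent E)"
    by (auto simp: sym_def adjacent_def insert_commute)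
  then show "(u, v) \<in> (adjacent E)\<^sup>* \<Longrightarrow> (v, u) \<in> (adjacent E)\<^sup>*"
    using sym_rtrancl[of "adjacent E"] by (meson symD)
qed

lemma rtrancl_adjacent_mono:
  "E \<subseteq> E' \<Longrightarrow> (u, v) \<in> (adjacent E)\<^sup>* \<Longrightarrow> (u, v) \<in> (adjacent E')\<^sup>*"
  using rtrancl_mono[of "adjacent E" "adjacent E'"] by (auto simp: adjacent_def)

lemma adjacent_edge: "{u, v} \<in> E \<Longrightarrow> (u, v) \<in> (adjacent E)\<^sup>*"
  by (auto simp: adjacent_def)

text \<open>A walk that crosses \<open>e\<close> either comes back to the end where it first met
  \<open>e\<close>, and the excursion can be cut out, or finally leaves from the other end. Most
  separation arguments below rest on this dichotomy.\<close>

lemma rtrancl_adjacent_delete_edge: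
  assumes "(v, w) \<in> (adjacent E)\<^sup>*"
  shows "(v, w) \<in> (adjacent (E - {e}))\<^sup>* \<or>
    (\<exists>a b. e = {a, b} \<and> (v, a) \<in> (adjacent (E - {e}))\<^sup>* \<and> (b, w) \<in> (adjacent (E - {e}))\<^sup>*)"
  using assms
proof induction
  case base
  then show ?case by simp
next
  case (step y z)
  show ?case
  proof (cases "{y, z} = e")
    case True
    then show ?thesis
      using step.IH by (smt (verit) doubleton_eq_iff rtrancl.rtrancl_refl)
  next
    case False
    then have "(y, z) \<in> adjacent (E - {e})"
      using step.hyps by (auto simp: adjacent_def)
    then show ?thesis
      using step.IH rtrancl_into_rtrancl by metis
  qed
qed

text \<open>A circuit is a list without repetitions, so reachability has to be turned into a simple
  path: a step to a vertex already listed cuts the list back to that vertex.\<close>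

lemma rtrancl_distinct_path:
  assumes "(a, b) \<in> R\<^sup>*"
  shows "\<exists>xs. xs \<noteq> [] \<and> xs ! 0 = a \<and> last xs = b \<and> distinct xs \<and>
    (\<forall>i. Suc i < length xs \<longrightarrow> (xs ! i, xs ! Suc i) \<in> R)"
  using assms
proof induction
  case base
  show ?case by (rule exI[of _ "[a]"]) auto
next
  case (step y z)
  then obtain xs where xs: "xs \<noteq> []" "xs ! 0 = a" "last xs = y" "distinct xs"
    "\<And>i. Suc i < length xs \<Longrightarrow> (xs ! i, xs ! Suc i) \<in> R"
    by blast
  show ?case
  proof (cases "z \<in> set xs")
    case True
    then obtain k where k: "k < length xs" "xs ! k = z"
      by (auto simp: in_set_conv_nth)
    show ?thesis
      using xs k
      by (intro exI[of _ "take (Suc k) xs"]) (auto simp: last_conv_nth min_absorb2 simp del: take_Suc)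
  next
    case False
    have "(xs ! i, z) \<in> R" if "Suc i = length xs" for i
      using that step.hyps(2) xs by (auto simp: last_conv_nth simp flip: that)
    then show ?thesis
      using xs False step.hyps(2)
      by (intro exI[of _ "xs @ [z]"])
        (auto simp: nth_append last_conv_nth not_less less_Suc_eq dest!: Suc_lessI)
  qed
qed

section \<open>Rooted trees and the two sides of an edge\<close>

locale rooted_tree =
  fixes V :: "'v set" and E :: "'v set set" and r :: 'v
  assumes tree: "tree_graph (V, E)" and root: "r \<in> V"
begin

lemma finite_V: "finite V"
  using tree by (simp add: tree_graph_def is_graph_def)

lemma edgeE:
  assumes "e \<in> E"
  obtains a b where "a \<in> V" "b \<in> V" "a \<noteq> b" "e = {a, b}"
  using tree assms by (auto simp: tree_graph_def is_graph_def)

lemma edge_in_V: "e \<in> E \<Longrightarrow> v \<in> e \<Longrightarrow> v \<in> V"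
  by (elim edgeE) auto

lemma finite_E: "finite E"
proof -
  have "E \<subseteq> Pow V" using edge_in_V by auto
  then show ?thesis using finite_V finite_subset by blast
qed

lemma connected: "u \<in> V \<Longrightarrow> v \<in> V \<Longrightarrow> (u, v) \<in> (adjacent E)\<^sup>*"
  using tree by (simp add: tree_graph_def connected_graph_def)

text \<open>A simple path from \<open>a\<close> to \<open>b\<close> avoiding the edge would close up
  with it to a circuit. Its length is at least three: one vertex would force \<open>a = b\<close>,
  and two would make the path the deleted edge itself.\<close>

lemma bridge:
  assumes "{a, b} \<in> E"
  shows "(a, b) \<notin> (adjacent (E - {{a, b}}))\<^sup>*"
proof
  assume "(a, b) \<in> (adjacent (E - {{a, b}}))\<^sup>*"
  from rtrancl_distinct_path[OF this] obtain xs where xs: "xs \<noteq> []" "xs ! 0 = a"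
      "last xs = b" "distinct xs"
      "\<And>i. Suc i < length xs \<Longrightarrow> {xs ! i, xs ! Suc i} \<in> E - {{a, b}}"
    by (auto simp: adjacent_def)
  have "a \<noteq> b" using assms by (elim edgeE) auto
  then have "length xs \<noteq> 1"
    using xs by (auto simp: last_conv_nth)
  moreover have "length xs \<noteq> 2"
    using xs(5)[of 0] xs by (auto simp: last_conv_nth)
  moreover have "length xs \<noteq> 0" using xs by simp
  ultimately have len: "3 \<le> length xs" by linarith
  have edge: "{xs ! i, xs ! (Suc i mod length xs)} \<in> E" if "i < length xs" for i
  proof (cases "Suc i = length xs")
    case True
    then have "{xs ! i, xs ! (Suc i mod length xs)} = {a, b}"
      using xs by (auto simp: last_conv_nth insert_commute simp flip: True)
    then show ?thesis using assms by simp
  next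
    case False
    then show ?thesis using xs(5)[of i] that by simp
  qed
  have "set xs \<subseteq> V"
    using edge edge_in_V by (fastforce simp: in_set_conv_nth)
  then have "circuit (V, E) xs"
    using len edge xs by (simp add: circuit_def)
  then show False using tree by (simp add: tree_graph_def)
qed

text \<open>The component cut off from the root by deleting \<open>e\<close>. Stating it by
  reachability makes membership invariant along every walk that avoids \<open>e\<close>; the set is
  empty when \<open>e\<close> is not an edge.\<close>

definition below :: "'v set \<Rightarrow> 'v set"
  where "below e = {v \<in> V. (r, v) \<notin> (adjacent (E - {e}))\<^sup>*}"

lemma below_cong_reach:
  assumes "(u, v) \<in> (adjacent (E - {e}))\<^sup>*" "u \<in> V" "v \<in> V"
  shows "u \<in> below e \<longleftrightarrow> v \<in> below e"
  using assms sym_rtrancl_adjacent[OF assms(1)] by (auto simp: below_def dest: rtrancl_trans)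

lemma below_cong_edge:
  assumes "{u, v} \<in> E" "{u, v} \<noteq> e"
  shows "u \<in> below e \<longleftrightarrow> v \<in> below e"
  using assms edge_in_V[OF assms(1)] by (intro below_cong_reach adjacent_edge) auto

lemma root_not_below: "r \<notin> below e"
  by (simp add: below_def)

text \<open>If neither end were cut off, both would be joined through the root, contrary to
  \<open>bridge\<close>. Both cannot be cut off, because a walk from the root to one of them reaches
  some end of \<open>e\<close> before crossing \<open>e\<close>.\<close>

lemma bottom_ex:
  assumes "e \<in> E"
  obtains a b where "e = {a, b}" "a \<noteq> b" "a \<in> V" "b \<in> V" "a \<notin> below e" "b \<in> below e"
proof -
  obtain a b where e: "e = {a, b}" "a \<in> V" "b \<in> V" "a \<noteq> b"
    using assms by (elim edgeE) auto
  have br: "(a, b) \<notin> (adjacent (E - {e}))\<^sup>*"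
    using bridge[of a b] assms e by simp
  then have not_both: "\<not> (a \<notin> below e \<and> b \<notin> below e)"
    using e unfolding below_def by (auto dest: sym_rtrancl_adjacent intro: rtrancl_trans)
  have "\<not> (a \<in> below e \<and> b \<in> below e)"
    using rtrancl_adjacent_delete_edge[OF connected[OF root e(2)], of e] e
    by (auto simp: below_def doubleton_eq_iff)
  then show thesis using that[of a b] that[of b a] not_both e
    by (auto simp: insert_commute)
qed

definition bottom :: "'v set \<Rightarrow> 'v"
  where "bottom e = (THE b. b \<in> e \<and> b \<in> below e)"

lemma bottomE:
  assumes "e \<in> E"
  obtains a where "e = {a, bottom e}" "a \<noteq> bottom e" "a \<in> V" "a \<notin> below e"
proof -
  obtain a b where ab: "e = {a, b}" "a \<noteq> b" "a \<in> V" "b \<in> V" "a \<notin> below e" "b \<in> below e"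
    using bottom_ex[OF assms] .
  then have "bottom e = b" unfolding bottom_def by (intro the_equality) auto
  then show thesis using ab that by auto
qed

lemma bottom: "e \<in> E \<Longrightarrow> bottom e \<in> e" "e \<in> E \<Longrightarrow> bottom e \<in> below e" "e \<in> E \<Longrightarrow> bottom e \<in> V"
proof -
  assume e: "e \<in> E"
  obtain a b where ab: "e = {a, b}" "a \<noteq> b" "a \<in> V" "b \<in> V" "a \<notin> below e" "b \<in> below e"
    using bottom_ex[OF e] .
  then have "bottom e = b" unfolding bottom_def by (intro the_equality) auto
  then show "bottom e \<in> e" "bottom e \<in> below e" "bottom e \<in> V" using ab by auto
qed

lemma bottom_unique: "e \<in> E \<Longrightarrow> v \<in> e \<Longrightarrow> v \<in> below e \<Longrightarrow> v = bottom e"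
  by (metis bottomE empty_iff insert_iff)

lemma mem_edge_below:
  assumes "f \<in> E" "f \<noteq> e" "u \<in> f" "v \<in> f"
  shows "u \<in> below e \<longleftrightarrow> v \<in> below e"
proof (cases "u = v")
  case False
  then have "f = {u, v}" using assms by (elim edgeE) auto
  then show ?thesis using below_cong_edge assms by blast
qed simp

text \<open>The last crossing of \<open>e\<close> on a walk from the root to \<open>w\<close> leaves
  from an end on the side of \<open>w\<close>, hence from \<open>bottom e\<close>.\<close>

lemma below_iff_reach_bottom:
  assumes "e \<in> E" "w \<in> V"
  shows "w \<in> below e \<longleftrightarrow> (bottom e, w) \<in> (adjacent (E - {e}))\<^sup>*"
proof
  assume "(bottom e, w) \<in> (adjacent (E - {e}))\<^sup>*"
  then show "w \<in> below e" using below_cong_reach bottom assms by blast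
next
  assume w: "w \<in> below e"
  obtain a where a: "e = {a, bottom e}" "a \<notin> below e" "a \<in> V" by (rule bottomE[OF assms(1)])
  have "(r, w) \<notin> (adjacent (E - {e}))\<^sup>*" using w by (simp add: below_def)
  then obtain c b where cb: "e = {c, b}" "(b, w) \<in> (adjacent (E - {e}))\<^sup>*"
    using rtrancl_adjacent_delete_edge[OF connected[OF root assms(2)], of e] by auto
  have "b \<in> V" using cb assms edge_in_V by auto
  then have "b \<in> below e" using below_cong_reach[OF cb(2)] w assms by blast
  then have "b = bottom e" using cb bottom_unique[OF assms(1)] by blast
  then show "(bottom e, w) \<in> (adjacent (E - {e}))\<^sup>*" using cb by simp
qed

text \<open>A walk from the root to \<open>v\<close> that avoids \<open>e\<close> must cross
  \<open>f\<close>. Up to that crossing it reaches an end of \<open>f\<close> without using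
  \<open>e\<close>, so this end, and with it \<open>bottom f\<close>, would not be below
  \<open>e\<close>.\<close>

lemma below_mono:
  assumes "e \<in> E" "f \<in> E" "bottom f \<in> below e"
  shows "below f \<subseteq> below e"
proof (cases "e = f")
  case False
  show ?thesis
  proof
    fix v assume v: "v \<in> below f"
    show "v \<in> below e"
    proof (rule ccontr)
      assume ne: "v \<notin> below e"
      have vV: "v \<in> V" using v by (simp add: below_def)
      have "(r, v) \<in> (adjacent (E - {e}))\<^sup>*" using ne vV by (simp add: below_def)
      moreover have "(r, v) \<notin> (adjacent (E - {e} - {f}))\<^sup>*"
        using v rtrancl_adjacent_mono[of "E - {e} - {f}" "E - {f}"] by (auto simp: below_def)
      ultimately obtain a b where ab: "f = {a, b}" "(r, a) \<in> (adjacent (E - {e} - {f}))\<^sup>*"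
        using rtrancl_adjacent_delete_edge[of r v "E - {e}" f] by auto
      have "(r, a) \<in> (adjacent (E - {e}))\<^sup>*"
        using ab rtrancl_adjacent_mono[of "E - {e} - {f}" "E - {e}"] by auto
      then have "a \<notin> below e" by (simp add: below_def)
      then show False
        using mem_edge_below[of f e a "bottom f"] assms ab bottom False by auto
    qed
  qed
qed simp

text \<open>Mirror image of \<open>below_mono\<close>: a common vertex is reached from
  \<open>bottom e\<close> without \<open>e\<close>. This walk crosses \<open>f\<close>, and its
  remainder puts an end of \<open>f\<close>, hence \<open>bottom f\<close>, below
  \<open>e\<close>.\<close>

lemma below_disjoint:
  assumes "e \<in> E" "f \<in> E" "bottom f \<notin> below e" "bottom e \<notin> below f"
  shows "below e \<inter> below f = {}"
proof (rule ccontr)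
  assume "below e \<inter> below f \<noteq> {}"
  then obtain v where v: "v \<in> below e" "v \<in> below f" by auto
  have ef: "e \<noteq> f" using assms bottom by auto
  have "(bottom e, v) \<in> (adjacent (E - {e}))\<^sup>*"
    using v below_iff_reach_bottom assms by (auto simp: below_def)
  moreover have "(bottom e, v) \<notin> (adjacent (E - {e} - {f}))\<^sup>*"
  proof
    assume "(bottom e, v) \<in> (adjacent (E - {e} - {f}))\<^sup>*"
    then have "(bottom e, v) \<in> (adjacent (E - {f}))\<^sup>*"
      using rtrancl_adjacent_mono[of "E - {e} - {f}" "E - {f}"] by auto
    then show False using below_cong_reach[of "bottom e" v f] v assms bottom
      by (auto simp: below_def)
  qed
  ultimately obtain a b where ab: "f = {a, b}" "(b, v) \<in> (adjacent (E - {e} - {f}))\<^sup>*"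
    using rtrancl_adjacent_delete_edge[of "bottom e" v "E - {e}" f] by auto
  have "(b, v) \<in> (adjacent (E - {e}))\<^sup>*"
    using ab rtrancl_adjacent_mono[of "E - {e} - {f}" "E - {e}"] by auto
  moreover have "b \<in> V" using ab edge_in_V assms by auto
  ultimately have "b \<in> below e"
    using below_cong_reach[of b v e] v by (auto simp: below_def)
  then show False
    using mem_edge_below[of f e b "bottom f"] assms ab bottom ef by auto
qed

text \<open>The sets \<open>below e\<close> form a laminar family, which is what turns inclusion of
  clusters into the tree order.\<close>

lemma below_nested:
  assumes "e \<in> E" "f \<in> E" "below e \<inter> below f \<noteq> {}"
  shows "below f \<subseteq> below e \<or> below e \<subseteq> below f"
  using below_disjoint[OF assms(1,2)] below_mono assms by metis

text \<open>Deleting \<open>e\<close> leaves the ends of any other edge \<open>f\<close> on one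
  side, while \<open>f\<close> separates its own ends.\<close>

lemma below_inj:
  assumes "e \<in> E" "f \<in> E" "below e = below f"
  shows "e = f"
proof (rule ccontr)
  assume "e \<noteq> f"
  obtain a where "f = {a, bottom f}" "a \<notin> below f" using bottomE[OF assms(2)] by metis
  moreover have "bottom f \<in> below f" using bottom assms by blast
  ultimately show False
    using mem_edge_below[of f e a "bottom f"] assms \<open>e \<noteq> f\<close> by auto
qed

lemma bottom_inj:
  assumes "e \<in> E" "f \<in> E" "bottom e = bottom f"
  shows "e = f"
  using below_inj below_mono assms bottom by (metis subset_antisym)

lemma parent_edge_ex:
  assumes "v \<in> V" "v \<noteq> r"
  obtains e where "e \<in> E" "bottom e = v"
proof -
  \<comment> \<open>Only edges missing \<open>v\<close> are kept, so \<open>v\<close> becomes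
    isolated; a walk from the root then enters \<open>v\<close> for the first time through an edge
    \<open>{u, v}\<close> with \<open>u\<close> already reached.\<close>
  let ?E = "{e \<in> E. v \<notin> e}"
  have "v = r \<or> (r, v) \<in> (adjacent ?E)\<^sup>* \<or> (\<exists>u. {u, v} \<in> E \<and> (r, u) \<in> (adjacent ?E)\<^sup>*)"
  proof -
    have "(r, w) \<in> (adjacent ?E)\<^sup>* \<or> (\<exists>u. {u, v} \<in> E \<and> (r, u) \<in> (adjacent ?E)\<^sup>*)"
      if "(r, w) \<in> (adjacent E)\<^sup>*" for w
      using that
    proof induction
      case (step y z)
      show ?case
      proof (cases "\<exists>u. {u, v} \<in> E \<and> (r, u) \<in> (adjacent ?E)\<^sup>*")
        case False
        with step.IH have y: "(r, y) \<in> (adjacent ?E)\<^sup>*" by simp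
        have yz: "{y, z} \<in> E" using step by (simp add: adjacent_def)
        have "z \<noteq> v" using False y yz by auto
        moreover have "y \<noteq> v"
        proof
          assume "y = v"
          from y[unfolded this] show False
            by (cases rule: rtranclE) (use assms in \<open>auto simp: adjacent_def\<close>)
        qed
        ultimately have "(y, z) \<in> adjacent ?E" using yz by (simp add: adjacent_def)
        then show ?thesis using y by (meson rtrancl.rtrancl_into_rtrancl)
      qed simp
    qed simp
    then show ?thesis using connected[OF root assms(1)] by blast
  qed
  moreover have "(r, v) \<notin> (adjacent ?E)\<^sup>*"
  proof
    assume "(r, v) \<in> (adjacent ?E)\<^sup>*"
    then show False by (cases rule: rtranclE) (use assms in \<open>auto simp: adjacent_def\<close>)
  qed
  ultimately obtain u where u: "{u, v} \<in> E" "(r, u) \<in> (adjacent ?E)\<^sup>*"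
    using assms by auto
  have "(r, u) \<in> (adjacent (E - {{u, v}}))\<^sup>*"
    using u by (intro rtrancl_adjacent_mono[of ?E "E - {{u, v}}"]) auto
  then have "u \<notin> below {u, v}" by (simp add: below_def)
  then have "bottom {u, v} = v"
    using bottom(1)[OF u(1)] bottom(2)[OF u(1)] by auto
  then show thesis using that u by blast
qed

text \<open>If deleting one more edge \<open>e\<close> disconnects \<open>v\<close> from
  \<open>w\<close>, then one end of \<open>e\<close> is still joined to \<open>v\<close> and the
  other to \<open>w\<close>, so \<open>e\<close> would separate them. With the surviving edges as
  \<open>A\<close>, this describes the vertices merged by a contraction.\<close>

lemma reach_delete_edges:
  assumes "finite A" "A \<subseteq> E" "v \<in> V" "w \<in> V" "\<And>e. e \<in> A \<Longrightarrow> v \<in> below e \<longleftrightarrow> w \<in> below e"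
  shows "(v, w) \<in> (adjacent (E - A))\<^sup>*"
  using assms
proof (induction A rule: finite_induct)
  case empty
  then show ?case using connected by simp
next
  case (insert e A)
  show ?case
  proof (rule ccontr)
    have eq: "E - insert e A = (E - A) - {e}" by auto
    assume "(v, w) \<notin> (adjacent (E - insert e A))\<^sup>*"
    moreover have "(v, w) \<in> (adjacent (E - A))\<^sup>*" using insert by auto
    ultimately obtain a b where ab: "e = {a, b}" "(v, a) \<in> (adjacent (E - A - {e}))\<^sup>*"
        "(b, w) \<in> (adjacent (E - A - {e}))\<^sup>*"
      using rtrancl_adjacent_delete_edge[of v w "E - A" e] eq by auto
    have "(v, a) \<in> (adjacent (E - {e}))\<^sup>*" "(b, w) \<in> (adjacent (E - {e}))\<^sup>*"
      using ab rtrancl_adjacent_mono[of "E - A - {e}" "E - {e}"] by auto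
    moreover have "a \<in> V" "b \<in> V" using ab edge_in_V insert.prems by auto
    ultimately have "a \<in> below e \<longleftrightarrow> b \<in> below e"
      using below_cong_reach insert.prems by blast
    moreover obtain a' b' where "e = {a', b'}" "a' \<notin> below e" "b' \<in> below e"
      using bottom_ex insert.prems by (metis insert_subset)
    ultimately show False using ab by (metis doubleton_eq_iff)
  qed
qed

end

section \<open>Contraction of edges in a tree\<close>

lemma contract_vertex_eq_iff:
  "contract_vertex S u = contract_vertex S v \<longleftrightarrow> (u, v) \<in> (adjacent S)\<^sup>*"
proof
  assume "contract_vertex S u = contract_vertex S v"
  then have "v \<in> contract_vertex S u" by (simp add: contract_vertex_def)
  then show "(u, v) \<in> (adjacent S)\<^sup>*" by (simp add: contract_vertex_def)
next
  assume "(u, v) \<in> (adjacent S)\<^sup>*"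
  then show "contract_vertex S u = contract_vertex S v"
    using sym_rtrancl_adjacent[of u v S]
    unfolding contract_vertex_def by (auto intro: rtrancl_trans)
qed

context rooted_tree
begin

text \<open>Equal images would join the ends of \<open>e\<close> through \<open>f\<close> and
  contracted edges, contradicting \<open>bridge\<close>. So no parallel edges arise, and an edge of
  the contraction can be traced back to the tree.\<close>

lemma contract_edge_inj:
  assumes "S \<subseteq> E" "e \<in> E - S" "f \<in> E - S"
    and eq: "contract_vertex S ` e = contract_vertex S ` f"
  shows "e = f"
proof (rule ccontr)
  assume "e \<noteq> f"
  obtain a b where ab: "e = {a, b}" using assms by (blast elim: edgeE)
  obtain c d where cd: "f = {c, d}" using assms by (blast elim: edgeE)
  have S: "(u, v) \<in> (adjacent (E - {e}))\<^sup>*" if "contract_vertex S u = contract_vertex S v" for u v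
    using that assms rtrancl_adjacent_mono[of S "E - {e}" u v] by (auto simp: contract_vertex_eq_iff)
  have "(c, d) \<in> (adjacent (E - {e}))\<^sup>*" "(d, c) \<in> (adjacent (E - {e}))\<^sup>*"
    using assms cd \<open>e \<noteq> f\<close> by (auto intro!: adjacent_edge simp: insert_commute)
  moreover have "(a, c) \<in> (adjacent (E - {e}))\<^sup>* \<and> (d, b) \<in> (adjacent (E - {e}))\<^sup>* \<or>
      (a, d) \<in> (adjacent (E - {e}))\<^sup>* \<and> (c, b) \<in> (adjacent (E - {e}))\<^sup>*"
    using eq S unfolding ab cd by (auto simp: doubleton_eq_iff sym_rtrancl_adjacent)
  ultimately have "(a, b) \<in> (adjacent (E - {e}))\<^sup>*"
    by (meson rtrancl_trans)
  then show False using bridge assms ab by auto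
qed

text \<open>Consecutive edges of a walk in the contraction meet only up to contracted edges, but
  these differ from \<open>e\<close>, so the gaps can be filled. Conversely a step of a walk in the
  tree is either collapsed or, by \<open>contract_edge_inj\<close>, becomes an edge other than the
  image of \<open>e\<close>.\<close>

lemma reach_contract_iff:
  assumes "S \<subseteq> E" "e \<in> E - S"
  shows "(contract_vertex S u, contract_vertex S v)
      \<in> (adjacent (snd (contract S (V, E)) - {contract_vertex S ` e}))\<^sup>* \<longleftrightarrow>
    (u, v) \<in> (adjacent (E - {e}))\<^sup>*" (is "_ \<in> (adjacent ?E')\<^sup>* \<longleftrightarrow> _")
proof
  have S: "(u, v) \<in> (adjacent (E - {e}))\<^sup>*" if "contract_vertex S u = contract_vertex S v" for u v
    using that assms rtrancl_adjacent_mono[of S "E - {e}" u v] by (auto simp: contract_vertex_eq_iff)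
  \<comment> \<open>The walk ends in a class \<open>X\<close>; its representative \<open>v\<close>
    stays arbitrary because the next edge may attach at another one.\<close>
  have "(u, v) \<in> (adjacent (E - {e}))\<^sup>*"
    if "(contract_vertex S u, X) \<in> (adjacent ?E')\<^sup>*" "X = contract_vertex S v" for X v
    using that
  proof (induction arbitrary: v)
    case base
    then show ?case using S by simp
  next
    case (step Y Z)
    then obtain f where f: "f \<in> E - S" "f \<noteq> e" "{Y, Z} = contract_vertex S ` f"
      by (auto simp: adjacent_def contract_def)
    obtain c d where "f = {c, d}" using f by (blast elim: edgeE)
    then obtain c d where cd: "f = {c, d}" "Y = contract_vertex S c" "Z = contract_vertex S d"
      using f by (auto simp: doubleton_eq_iff insert_commute)
    have "(u, c) \<in> (adjacent (E - {e}))\<^sup>*" using step.IH cd by simp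
    moreover have "(c, d) \<in> (adjacent (E - {e}))\<^sup>*"
      using f cd by (intro adjacent_edge) auto
    moreover have "(d, v) \<in> (adjacent (E - {e}))\<^sup>*"
      using S cd step.prems by simp
    ultimately show ?case by (meson rtrancl_trans)
  qed
  then show "(contract_vertex S u, contract_vertex S v) \<in> (adjacent ?E')\<^sup>* \<Longrightarrow>
      (u, v) \<in> (adjacent (E - {e}))\<^sup>*" by simp
next
  assume "(u, v) \<in> (adjacent (E - {e}))\<^sup>*"
  then show "(contract_vertex S u, contract_vertex S v) \<in> (adjacent ?E')\<^sup>*"
  proof induction
    case (step y z)
    then have yz: "{y, z} \<in> E" "{y, z} \<noteq> e" by (auto simp: adjacent_def)
    show ?case
    proof (cases "{y, z} \<in> S")
      case True
      then have "contract_vertex S y = contract_vertex S z"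
        using adjacent_edge by (simp add: contract_vertex_eq_iff)
      then show ?thesis using step.IH by simp
    next
      case False
      then have "contract_vertex S ` {y, z} \<noteq> contract_vertex S ` e"
        using contract_edge_inj[OF assms(1), of "{y, z}" e] yz assms by auto
      moreover have "contract_vertex S ` {y, z} \<in> snd (contract S (V, E))"
        unfolding contract_def snd_conv using yz False by blast
      ultimately have "(contract_vertex S y, contract_vertex S z) \<in> adjacent ?E'"
        by (simp add: adjacent_def)
      then show ?thesis using step.IH by (meson rtrancl.rtrancl_into_rtrancl)
    qed
  qed simp
qed

end

section \<open>Clusters of leaf labels\<close>

text \<open>The given data label pendant edges, whereas being cut off is easiest to express for
  leaves, so both \<open>pendant\<close> and \<open>l\<close> are parameters.\<close>

locale leaf_labelled_tree = rooted_tree V E "l 0"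
  for V :: "'v set" and E :: "'v set set" and l :: "nat \<Rightarrow> 'v" +
  fixes n :: nat and pendant :: "nat \<Rightarrow> 'v set"
  assumes trivalent: "trivalent (V, E)"
    and labels: "bij_betw l {..<n} (leaves (V, E))"
    and n_pos: "0 < n"
    and pendant: "k < n \<Longrightarrow> pendant k \<in> E" "k < n \<Longrightarrow> l k \<in> pendant k"
begin

lemma leaf_edge_unique:
  assumes "v \<in> leaves (V, E)" "e \<in> E" "f \<in> E" "v \<in> e" "v \<in> f"
  shows "e = f"
proof -
  have "card (edges_at (V, E) v) = 1" using assms by (simp add: leaves_def degree_def)
  then obtain x where "edges_at (V, E) v = {x}" by (rule card_1_singletonE)
  moreover have "e \<in> edges_at (V, E) v" "f \<in> edges_at (V, E) v"
    using assms by (auto simp: edges_at_def)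
  ultimately show ?thesis by simp
qed

lemma internal_edges:
  assumes "v \<in> V" "v \<notin> leaves (V, E)" "e \<in> E" "v \<in> e"
  obtains g h where "g \<in> E" "h \<in> E" "v \<in> g" "v \<in> h" "g \<noteq> e" "h \<noteq> e" "g \<noteq> h"
proof -
  have "card (edges_at (V, E) v) = 3"
    using assms trivalent by (auto simp: leaves_def degree_def trivalent_def)
  then have "card (edges_at (V, E) v - {e}) = 2"
    using assms by (simp add: card_Diff_singleton edges_at_def)
  then obtain g h where gh: "edges_at (V, E) v - {e} = {g, h}" "g \<noteq> h"
    by (auto simp: card_2_iff)
  then have "g \<in> edges_at (V, E) v - {e}" "h \<in> edges_at (V, E) v - {e}" by simp_all
  then show thesis using that[of g h] gh(2) by (simp add: edges_at_def)
qed

lemma leaf_isolated: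
  assumes "v \<in> leaves (V, E)" "e \<in> E" "v \<in> e" "(v, w) \<in> (adjacent (E - {e}))\<^sup>*"
  shows "w = v"
  using assms(4)
proof (cases rule: converse_rtranclE)
  case (step y)
  then have "{v, y} \<in> E" "{v, y} \<noteq> e" by (auto simp: adjacent_def)
  then show ?thesis using leaf_edge_unique assms by blast
qed simp

lemma leaf_label: "v \<in> leaves (V, E) \<Longrightarrow> \<exists>k<n. v = l k"
  using labels by (auto simp: bij_betw_def)

lemma label_leaf: "k < n \<Longrightarrow> l k \<in> leaves (V, E)"
  using labels by (auto simp: bij_betw_def)

lemma label_in_V: "k < n \<Longrightarrow> l k \<in> V"
  using label_leaf by (auto simp: leaves_def)

lemma label_inj: "j < n \<Longrightarrow> k < n \<Longrightarrow> l j = l k \<longleftrightarrow> j = k"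
  using labels by (auto simp: bij_betw_def inj_on_def)

lemma finite_below: "finite (below e)"
  using finite_V by (auto simp: below_def)

lemma child_below:
  assumes "e \<in> E" "g \<in> E" "bottom e \<in> g" "g \<noteq> e"
  shows "below g \<subseteq> below e" "bottom e \<notin> below g"
proof -
  have "bottom g \<in> below e"
    using mem_edge_below[of g e "bottom g" "bottom e"] assms bottom by auto
  then show "below g \<subseteq> below e" using below_mono assms by blast
  show "bottom e \<notin> below g"
    using bottom_unique[OF assms(2,3)] bottom_inj assms by auto
qed

text \<open>Descending from \<open>bottom e\<close> along another edge shrinks the cut-off part
  strictly, since \<open>bottom e\<close> itself drops out; the descent can stop only at a
  leaf.\<close>

lemma label_below: "e \<in> E \<Longrightarrow> \<exists>k<n. l k \<in> below e"
proof (induction "card (below e)" arbitrary: e rule: less_induct)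
  case less
  show ?case
  proof (cases "bottom e \<in> leaves (V, E)")
    case True
    then show ?thesis using leaf_label bottom less.prems by metis
  next
    case False
    then obtain g where g: "g \<in> E" "bottom e \<in> g" "g \<noteq> e"
      using internal_edges bottom less.prems by metis
    then have "below g \<subset> below e"
      using child_below[OF less.prems g(1)] bottom less.prems by blast
    then have "card (below g) < card (below e)" by (simp add: finite_below psubset_card_mono)
    then show ?thesis using less.hyps g \<open>below g \<subset> below e\<close> by blast
  qed
qed

text \<open>Only this separation uses that internal vertices have degree at least three: below \<open>bottom e\<close>
  there are two branches, and \<open>f\<close> meets at most one of them.\<close>

lemma label_below_diff:
  assumes "e \<in> E" "f \<in> E" "e \<noteq> f" "below f \<subseteq> below e"
  shows "\<exists>k<n. l k \<in> below e - below f"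
proof -
  let ?v = "bottom e"
  have vf: "?v \<notin> below f"
    using below_mono[OF assms(2,1)] below_inj assms by auto
  have "?v \<notin> leaves (V, E)"
  proof
    assume leaf: "?v \<in> leaves (V, E)"
    have "bottom f \<in> below e" "bottom f \<in> V" using assms bottom by auto
    then have "(?v, bottom f) \<in> (adjacent (E - {e}))\<^sup>*"
      using below_iff_reach_bottom assms by blast
    then have "bottom f = ?v" using leaf_isolated[OF leaf] bottom assms by blast
    then show False using bottom_inj assms by auto
  qed
  then obtain g h where gh: "g \<in> E" "h \<in> E" "?v \<in> g" "?v \<in> h" "g \<noteq> e" "h \<noteq> e" "g \<noteq> h"
    using internal_edges bottom assms by metis
  have not_below: "bottom g' \<notin> below f" if "g' \<in> E" "?v \<in> g'" "g' \<noteq> f" for g'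
    using mem_edge_below[of g' f "bottom g'" ?v] that vf bottom by auto
  have "bottom h \<notin> below g" "bottom g \<notin> below h"
    using mem_edge_below[of h g "bottom h" ?v] mem_edge_below[of g h "bottom g" ?v]
      child_below(2)[OF assms(1)] gh bottom by auto
  then have disj: "below g \<inter> below h = {}" using below_disjoint gh by blast
  have "\<exists>g'\<in>{g, h}. below g' \<inter> below f = {}"
  proof (rule ccontr)
    assume "\<not> ?thesis"
    then have meet: "below g \<inter> below f \<noteq> {}" "below h \<inter> below f \<noteq> {}" by auto
    \<comment> \<open>Only \<open>f\<close> itself enters the part below \<open>f\<close>, so a
      branch other than \<open>f\<close> has its lower end outside and must contain all of
      \<open>below f\<close> once the two meet.\<close>
    have "below f \<subseteq> below g'" if g': "g' \<in> {g, h}" for g'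
    proof (cases "g' = f")
      case False
      then have "bottom g' \<notin> below f" using not_below gh g' by auto
      then have "bottom f \<in> below g'"
        using below_disjoint[of g' f] meet gh g' assms by auto
      then show ?thesis using below_mono gh g' assms by blast
    qed simp
    then have "below f \<subseteq> below g \<inter> below h" by simp
    then show False using disj meet by blast
  qed
  then obtain g' where g': "g' \<in> {g, h}" "below g' \<inter> below f = {}" by blast
  then have "g' \<in> E" "below g' \<subseteq> below e"
    using child_below(1)[OF assms(1)] gh by auto
  then show ?thesis using label_below[of g'] g' by blast
qed

definition cluster :: "'v set \<Rightarrow> nat set"
  where "cluster e = {k. k < n \<and> l k \<in> below e}"

text \<open>A label below \<open>f\<close> makes the two sides meet, so laminarity leaves only the
  reverse inclusion to treat; if the edges differ, \<open>label_below_diff\<close> supplies a label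
  below \<open>f\<close> but not below \<open>e\<close>.\<close>

lemma cluster_subset_iff:
  assumes "e \<in> E" "f \<in> E"
  shows "cluster f \<subseteq> cluster e \<longleftrightarrow> below f \<subseteq> below e"
proof
  assume sub: "cluster f \<subseteq> cluster e"
  obtain k where "k < n" "l k \<in> below f" using label_below assms by blast
  then have "below e \<inter> below f \<noteq> {}" using sub by (auto simp: cluster_def)
  then have "below f \<subseteq> below e \<or> below e \<subseteq> below f"
    using below_nested assms by blast
  moreover have "e = f" if "below e \<subseteq> below f"
    using label_below_diff[of f e] sub that assms by (fastforce simp: cluster_def)
  ultimately show "below f \<subseteq> below e" by blast
qed (auto simp: cluster_def)

lemma cluster_eq_iff: "e \<in> E \<Longrightarrow> f \<in> E \<Longrightarrow> cluster e = cluster f \<longleftrightarrow> e = f"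
  using cluster_subset_iff[of e f] cluster_subset_iff[of f e] below_inj by blast

lemma cluster_pendant_0: "cluster (pendant 0) = {0<..<n}"
proof -
  have "l k \<in> below (pendant 0)" if "0 < k" "k < n" for k
    using leaf_isolated[OF label_leaf[OF n_pos] pendant[OF n_pos], of "l k"]
      label_inj[of k 0] that label_in_V by (auto simp: below_def)
  moreover have "0 < k" if "l k \<in> below (pendant 0)" for k
    using root_not_below that by (intro gr0I) auto
  ultimately show ?thesis by (auto simp: cluster_def)
qed

text \<open>Together with \<open>cluster_pendant_0\<close> this shows that pendant edges have the
  same clusters in all trees with \<open>n\<close> labels, so that trees differ only in the clusters
  of bounded edges.\<close>

lemma cluster_pendant:
  assumes "0 < k" "k < n"
  shows "cluster (pendant k) = {k}"
proof -
  have lk: "l k \<in> V" "l k \<noteq> l 0" using assms label_in_V label_inj by auto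
  obtain e where e: "e \<in> E" "bottom e = l k" using parent_edge_ex[OF lk] .
  then have "e = pendant k"
    using leaf_edge_unique[OF label_leaf] bottom(1) pendant assms by metis
  then have b: "bottom (pendant k) = l k" using e by simp
  have "j = k" if j: "j < n" "l j \<in> below (pendant k)" for j
  proof -
    have "(l k, l j) \<in> (adjacent (E - {pendant k}))\<^sup>*"
      using below_iff_reach_bottom[of "pendant k" "l j"] b j pendant assms label_in_V by auto
    then have "l j = l k" using leaf_isolated[OF label_leaf] pendant assms by blast
    then show "j = k" using label_inj assms j by auto
  qed
  moreover have "l k \<in> below (pendant k)" using b bottom(2) pendant assms by metis
  ultimately show ?thesis using assms by (auto simp: cluster_def)
qed

end

text \<open>The graph obtained by contracting part of a tree is isomorphic to one built from the clusters
  of the remaining edges alone: a vertex becomes the set of the clusters of the edges above it, and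
  such a set is either empty (at the root) or of the form \<open>up \<C> C\<close>.\<close>

definition up :: "nat set set \<Rightarrow> nat set \<Rightarrow> nat set set"
  where "up \<C> C = {D \<in> \<C>. C \<subseteq> D}"

text \<open>The two ends of an edge lie below the same surviving edges except for the edge itself,
  so they differ exactly in the element \<open>C\<close>.\<close>

definition cluster_edge :: "nat set set \<Rightarrow> nat set \<Rightarrow> nat set set set"
  where "cluster_edge \<C> C = {up \<C> C, up \<C> C - {C}}"

definition cluster_graph :: "nat set set \<Rightarrow> nat set set graph"
  where "cluster_graph \<C> = (insert {} (up \<C> ` \<C>), cluster_edge \<C> ` \<C>)"

context leaf_labelled_tree
begin

context
  fixes S :: "'v set set"
  assumes S: "S \<subseteq> E"
begin

definition above :: "'v \<Rightarrow> nat set set"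
  where "above v = cluster ` {e \<in> E - S. v \<in> below e}"

lemma cluster_mem_above: "e \<in> E - S \<Longrightarrow> cluster e \<in> above v \<longleftrightarrow> v \<in> below e"
  using cluster_eq_iff by (auto simp: above_def)

text \<open>Removing the surviving edges leaves just \<open>S\<close>. Hence
  \<open>reach_delete_edges\<close>, applied to them, joins vertices that no surviving edge
  separates by contracted edges alone.\<close>

lemma above_eq_iff:
  assumes "v \<in> V" "w \<in> V"
  shows "above v = above w \<longleftrightarrow> contract_vertex S v = contract_vertex S w"
  unfolding contract_vertex_eq_iff
proof
  assume eq: "above v = above w"
  have "(v, w) \<in> (adjacent (E - (E - S)))\<^sup>*"
  proof (rule reach_delete_edges)
    show "v \<in> below e \<longleftrightarrow> w \<in> below e" if "e \<in> E - S" for e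
      using cluster_mem_above[OF that] eq by blast
  qed (use assms finite_E in auto)
  then show "(v, w) \<in> (adjacent S)\<^sup>*"
    using S by (simp add: double_diff)
next
  assume "(v, w) \<in> (adjacent S)\<^sup>*"
  then have "v \<in> below e \<longleftrightarrow> w \<in> below e" if "e \<in> E - S" for e
    using that S assms by (intro below_cong_reach rtrancl_adjacent_mono[of S "E - {e}"]) auto
  then show "above v = above w" by (auto simp: above_def)
qed

lemma above_bottom:
  assumes "e \<in> E - S"
  shows "above (bottom e) = up (cluster ` (E - S)) (cluster e)"
proof -
  have "bottom e \<in> below f \<longleftrightarrow> cluster e \<subseteq> cluster f" if "f \<in> E - S" for f
    using that assms cluster_subset_iff[of f e] below_mono[of f e] bottom(2)[of e] by auto
  then show ?thesis by (auto simp: above_def up_def)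
qed

lemma above_top:
  assumes e: "e \<in> E - S" "e = {a, bottom e}" "a \<notin> below e"
  shows "above a = above (bottom e) - {cluster e}"
proof -
  have "a \<in> e" by (subst e(2)) simp
  then have "a \<in> below f \<longleftrightarrow> bottom e \<in> below f" if "f \<in> E - S" "f \<noteq> e" for f
    using mem_edge_below[of e f a "bottom e"] bottom(1)[of e] e(1) that by blast
  moreover have "cluster e = cluster f \<longleftrightarrow> e = f" if "f \<in> E - S" for f
    using e(1) that cluster_eq_iff by blast
  moreover have "bottom e \<in> below e" using e(1) bottom(2) by blast
  ultimately show ?thesis
    using e(1,3) unfolding above_def by (intro equalityI subsetI) (auto split: if_splits)
qed

lemma above_edge:
  assumes "e \<in> E - S"
  shows "above ` e = cluster_edge (cluster ` (E - S)) (cluster e)"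
proof -
  obtain a where a: "e = {a, bottom e}" "a \<notin> below e"
    using bottomE assms by (metis DiffD1)
  have "above ` e = {above a, above (bottom e)}" using a(1) by (metis image_empty image_insert)
  then show ?thesis
    using above_top[OF assms a] above_bottom[OF assms] by (auto simp: cluster_edge_def)
qed

lemma above_vertices: "above ` V = insert {} (up (cluster ` (E - S)) ` cluster ` (E - S))"
proof (intro equalityI subsetI)
  fix X assume "X \<in> above ` V"
  then obtain v where v: "v \<in> V" "X = above v" by blast
  show "X \<in> insert {} (up (cluster ` (E - S)) ` cluster ` (E - S))"
  proof (cases "X = {}")
    case False
    \<comment> \<open>All edges in \<open>A\<close> have \<open>v\<close> below them, so by
      laminarity they form a chain; its members are exactly the surviving edges whose cluster
      contains that of the least one, \<open>e\<close>.\<close>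
    define A where "A = {e \<in> E - S. v \<in> below e}"
    have "A \<noteq> {}" using False v by (auto simp: A_def above_def)
    then obtain e where e: "e \<in> A" "\<And>f. f \<in> A \<Longrightarrow> card (below e) \<le> card (below f)"
      using ex_has_least_nat[of "\<lambda>e. e \<in> A" _ "\<lambda>e. card (below e)"] by blast
    have "below e \<subseteq> below f" if f: "f \<in> A" for f
    proof -
      have "below e \<inter> below f \<noteq> {}" using e(1) f by (auto simp: A_def)
      then have "below f \<subseteq> below e \<or> below e \<subseteq> below f"
        using below_nested[of e f] e(1) f by (auto simp: A_def)
      then show ?thesis
        using e(2)[OF f] finite_below card_seteq by blast
    qed
    then have "above v = up (cluster ` (E - S)) (cluster e)"
      using e(1) cluster_subset_iff by (fastforce simp: A_def above_def up_def)
    then show ?thesis using v e(1) by (auto simp: A_def)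
  qed simp
next
  fix X assume "X \<in> insert {} (up (cluster ` (E - S)) ` cluster ` (E - S))"
  then consider "X = {}" | e where "e \<in> E - S" "X = up (cluster ` (E - S)) (cluster e)" by blast
  then show "X \<in> above ` V"
  proof cases
    case 1
    then have "X = above (l 0)" using root_not_below by (simp add: above_def)
    then show ?thesis using root by blast
  next
    case 2
    then show ?thesis using above_bottom[of e] bottom(3)[of e] by (auto intro!: image_eqI)
  qed
qed

lemma contract_iso_cluster_graph:
  "\<exists>\<phi>. graph_iso \<phi> (contract S (V, E)) (cluster_graph (cluster ` (E - S))) \<and>
     (\<forall>e\<in>E - S. \<phi> ` contract_vertex S ` e = cluster_edge (cluster ` (E - S)) (cluster e))"
proof -
  \<comment> \<open>A vertex of the contraction is a class of vertices; the choice of a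
    representative does not matter by \<open>above_eq_iff\<close>.\<close>
  define \<phi> where "\<phi> X = above (SOME v. v \<in> V \<and> X = contract_vertex S v)" for X
  have \<phi>: "\<phi> (contract_vertex S v) = above v" if "v \<in> V" for v
  proof -
    let ?w = "SOME w. w \<in> V \<and> contract_vertex S v = contract_vertex S w"
    have "?w \<in> V \<and> contract_vertex S v = contract_vertex S ?w"
      by (rule someI[of _ v]) (use that in simp)
    then show ?thesis using above_eq_iff that by (auto simp: \<phi>_def)
  qed
  have edge: "\<phi> ` contract_vertex S ` e = cluster_edge (cluster ` (E - S)) (cluster e)"
    if "e \<in> E - S" for e
  proof -
    have "e \<subseteq> V" using that edge_in_V by auto
    then have "\<phi> ` contract_vertex S ` e = above ` e" using \<phi> by (force simp: image_image)
    then show ?thesis using above_edge that by simp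
  qed
  have inj: "inj_on \<phi> (contract_vertex S ` V)"
    using \<phi> above_eq_iff by (auto simp: inj_on_def)
  have "\<phi> ` contract_vertex S ` V = above ` V" using \<phi> by (force simp: image_image)
  then have "bij_betw \<phi> (fst (contract S (V, E))) (fst (cluster_graph (cluster ` (E - S))))"
    using inj above_vertices by (simp add: bij_betw_def contract_def cluster_graph_def)
  moreover have "bij_betw (image \<phi>) (snd (contract S (V, E)))
      (snd (cluster_graph (cluster ` (E - S))))"
  proof -
    have "(\<lambda>e. contract_vertex S ` e) ` (E - S) \<subseteq> Pow (contract_vertex S ` V)"
      using edge_in_V by (auto intro!: imageI)
    then have "inj_on (image \<phi>) ((\<lambda>e. contract_vertex S ` e) ` (E - S))"
      by (rule inj_on_subset[OF inj_on_image_Pow[OF inj]])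
    moreover have "image \<phi> ` (\<lambda>e. contract_vertex S ` e) ` (E - S) =
        cluster_edge (cluster ` (E - S)) ` cluster ` (E - S)"
      unfolding image_comp by (intro image_cong) (simp_all add: edge)
    ultimately show ?thesis by (simp add: bij_betw_def contract_def cluster_graph_def)
  qed
  ultimately show ?thesis using edge unfolding graph_iso_def by blast
qed

end

end

section \<open>Isomorphisms between contracted trees\<close>

lemma graph_iso_trans: "graph_iso F G G' \<Longrightarrow> graph_iso F' G' G'' \<Longrightarrow> graph_iso (F' \<circ> F) G G''"
proof -
  have "image (F' \<circ> F) = image F' \<circ> image F" by (auto simp: image_comp)
  then show "graph_iso F G G' \<Longrightarrow> graph_iso F' G' G'' \<Longrightarrow> graph_iso (F' \<circ> F) G G''"
    unfolding graph_iso_def by (metis bij_betw_trans)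
qed

lemma graph_iso_inv_into:
  assumes "graph_iso F G G'" "snd G \<subseteq> Pow (fst G)"
  shows "graph_iso (inv_into (fst G) F) G' G"
proof -
  let ?F' = "inv_into (fst G) F"
  have inj: "inj_on F (fst G)" using assms by (simp add: graph_iso_def bij_betw_def)
  have inv: "?F' ` F ` e = e" if "e \<in> snd G" for e
    using that assms(2) by (intro inv_into_image_cancel[OF inj]) auto
  have "snd G' = image F ` snd G" using assms by (simp add: graph_iso_def bij_betw_def)
  then have "bij_betw (image ?F') (snd G') (snd G)"
    unfolding bij_betw_def using inv by (force simp: image_image intro!: inj_onI)
  then show ?thesis
    using assms(1) by (simp add: graph_iso_def bij_betw_inv_into)
qed

lemma is_graph_edges: "is_graph G \<Longrightarrow> snd G \<subseteq> Pow (fst G)"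
  by (auto simp: is_graph_def)

lemma contract_edges: "snd G \<subseteq> Pow (fst G) \<Longrightarrow> snd (contract S G) \<subseteq> Pow (fst (contract S G))"
  by (auto simp: contract_def)

text \<open>Both contractions are isomorphic to the same \<open>cluster_graph\<close>, and one
  isomorphism is composed with the inverse of the other. Each sends an edge to the
  \<open>cluster_edge\<close> of its cluster, so edges with equal clusters correspond.\<close>

lemma contract_iso_of_clusters:
  assumes "leaf_labelled_tree V E l n pd" "leaf_labelled_tree V' E' l' n pd'"
    and "S \<subseteq> E" "S' \<subseteq> E'"
    and eq: "leaf_labelled_tree.cluster V E l n ` (E - S) =
      leaf_labelled_tree.cluster V' E' l' n ` (E' - S')"
  obtains F where "graph_iso F (contract S (V, E)) (contract S' (V', E'))"
    "\<And>e e'. \<lbrakk>e \<in> E - S; e' \<in> E' - S';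
        leaf_labelled_tree.cluster V E l n e = leaf_labelled_tree.cluster V' E' l' n e'\<rbrakk> \<Longrightarrow>
      F ` contract_vertex S ` e = contract_vertex S' ` e'"
proof -
  interpret T: leaf_labelled_tree V E l n pd by fact
  interpret T': leaf_labelled_tree V' E' l' n pd' by fact
  let ?C = "T.cluster ` (E - S)"
  obtain \<phi> where \<phi>: "graph_iso \<phi> (contract S (V, E)) (cluster_graph ?C)"
      "\<forall>e\<in>E - S. \<phi> ` contract_vertex S ` e = cluster_edge ?C (T.cluster e)"
    using T.contract_iso_cluster_graph[OF assms(3)] by (elim exE conjE)
  obtain \<psi> where \<psi>: "graph_iso \<psi> (contract S' (V', E')) (cluster_graph ?C)"
      "\<forall>e\<in>E' - S'. \<psi> ` contract_vertex S' ` e = cluster_edge ?C (T'.cluster e)"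
    using T'.contract_iso_cluster_graph[OF assms(4)] unfolding eq by (elim exE conjE)
  have edges: "E' \<subseteq> Pow V'" using T'.edge_in_V by blast
  have V': "fst (contract S' (V', E')) = contract_vertex S' ` V'" by (simp add: contract_def)
  let ?\<psi>' = "inv_into (contract_vertex S' ` V') \<psi>"
  have "graph_iso ?\<psi>' (cluster_graph ?C) (contract S' (V', E'))"
    using graph_iso_inv_into[OF \<psi>(1) contract_edges] edges V' by simp
  then have iso: "graph_iso (?\<psi>' \<circ> \<phi>) (contract S (V, E)) (contract S' (V', E'))"
    by (rule graph_iso_trans[OF \<phi>(1)])
  moreover have "(?\<psi>' \<circ> \<phi>) ` contract_vertex S ` e = contract_vertex S' ` e'"
    if "e \<in> E - S" "e' \<in> E' - S'" "T.cluster e = T'.cluster e'" for e e'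
  proof -
    have "\<phi> ` contract_vertex S ` e = \<psi> ` contract_vertex S' ` e'"
      using bspec[OF \<phi>(2) that(1)] bspec[OF \<psi>(2) that(2)] that(3) by simp
    moreover have "inj_on \<psi> (contract_vertex S' ` V')"
      using \<psi>(1) V' by (simp add: graph_iso_def bij_betw_def)
    moreover have "contract_vertex S' ` e' \<subseteq> contract_vertex S' ` V'"
      using that(2) edges by blast
    ultimately show ?thesis
      unfolding image_comp[symmetric] by (simp add: inv_into_image_cancel)
  qed
  ultimately show thesis by (rule that)
qed

text \<open>A description of clusters that does not single out the leaf of a pendant edge, so that it is
  visibly preserved by contractions and isomorphisms. For a bounded edge the choice of the endpoints
  \<open>u\<close> and \<open>v\<close> does not matter.\<close>

definition edge_cluster :: "nat \<Rightarrow> 'v set set \<Rightarrow> (nat \<Rightarrow> 'v set) \<Rightarrow> 'v set \<Rightarrow> nat set"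
  where "edge_cluster n E L e =
    {k. k < n \<and> (\<forall>u\<in>L k. \<forall>v\<in>L 0. (u, v) \<notin> (adjacent (E - {e}))\<^sup>*)}"

text \<open>Deleting an edge that is not pendant leaves the two ends of every pendant edge joined,
  so testing both ends amounts to testing the leaf \<open>l k\<close>.\<close>

lemma (in leaf_labelled_tree) edge_cluster_eq:
  assumes e: "e \<in> E" "e \<notin> pendant ` {..<n}"
  shows "edge_cluster n E pendant e = cluster e"
proof -
  have reach: "(u, l k) \<in> (adjacent (E - {e}))\<^sup>*" "(l k, u) \<in> (adjacent (E - {e}))\<^sup>*"
    if "k < n" "u \<in> pendant k" for k u
  proof -
    show "(u, l k) \<in> (adjacent (E - {e}))\<^sup>*"
    proof (cases "u = l k")
      case False
      then have "pendant k = {u, l k}" using that pendant[OF that(1)] by (elim edgeE) auto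
      then show ?thesis using e that pendant(1)[of k] by (intro adjacent_edge) auto
    qed simp
    then show "(l k, u) \<in> (adjacent (E - {e}))\<^sup>*" by (rule sym_rtrancl_adjacent)
  qed
  have "(\<forall>u\<in>pendant k. \<forall>v\<in>pendant 0. (u, v) \<notin> (adjacent (E - {e}))\<^sup>*) \<longleftrightarrow> l k \<in> below e"
    if k: "k < n" for k
  proof
    assume "\<forall>u\<in>pendant k. \<forall>v\<in>pendant 0. (u, v) \<notin> (adjacent (E - {e}))\<^sup>*"
    then have "(l k, l 0) \<notin> (adjacent (E - {e}))\<^sup>*" using pendant(2) k n_pos by blast
    then have "(l 0, l k) \<notin> (adjacent (E - {e}))\<^sup>*" by (blast dest: sym_rtrancl_adjacent)
    then show "l k \<in> below e" using label_in_V k by (simp add: below_def)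
  next
    assume b: "l k \<in> below e"
    have "(u, v) \<notin> (adjacent (E - {e}))\<^sup>*" if uv: "u \<in> pendant k" "v \<in> pendant 0" for u v
    proof
      assume "(u, v) \<in> (adjacent (E - {e}))\<^sup>*"
      then have "(l k, l 0) \<in> (adjacent (E - {e}))\<^sup>*"
        using reach(2)[OF k uv(1)] reach(1)[OF n_pos uv(2)] by (meson rtrancl_trans)
      then show False using b by (auto simp: below_def dest: sym_rtrancl_adjacent)
    qed
    then show "\<forall>u\<in>pendant k. \<forall>v\<in>pendant 0. (u, v) \<notin> (adjacent (E - {e}))\<^sup>*" by blast
  qed
  then show ?thesis by (auto simp: edge_cluster_def cluster_def)
qed

lemma (in rooted_tree) edge_cluster_contract:
  assumes "S \<subseteq> E" "e \<in> E - S"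
  shows "edge_cluster n (snd (contract S (V, E))) (\<lambda>k. contract_vertex S ` L k)
      (contract_vertex S ` e) = edge_cluster n E L e"
  by (simp add: edge_cluster_def reach_contract_iff[OF assms])

lemma reach_iso:
  assumes "graph_iso F G G'" "e \<in> snd G" "(u, v) \<in> (adjacent (snd G - {e}))\<^sup>*"
  shows "(F u, F v) \<in> (adjacent (snd G' - {F ` e}))\<^sup>*"
  using assms(3)
proof induction
  case (step y z)
  have bij: "bij_betw (image F) (snd G) (snd G')" using assms by (simp add: graph_iso_def)
  have yz: "{y, z} \<in> snd G" "{y, z} \<noteq> e" using step by (auto simp: adjacent_def)
  then have "F ` {y, z} \<noteq> F ` e" "F ` {y, z} \<in> snd G'"
    using bij assms(2) by (auto dest: bij_betw_apply simp: bij_betw_def inj_on_eq_iff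
        simp del: image_insert image_empty)
  then have "(F y, F z) \<in> adjacent (snd G' - {F ` e})" by (simp add: adjacent_def)
  then show ?case using step.IH by (meson rtrancl.rtrancl_into_rtrancl)
qed simp

text \<open>\<open>reach_iso\<close> transfers walks in one direction; the other comes from the
  inverse isomorphism, which takes the image of \<open>e\<close> back to \<open>e\<close> because
  edges consist of vertices.\<close>

lemma edge_cluster_iso:
  assumes iso: "graph_iso F G G'" and edges: "snd G \<subseteq> Pow (fst G)" and e: "e \<in> snd G"
    and L: "\<And>k. k < n \<Longrightarrow> L k \<subseteq> fst G" "\<And>k. k < n \<Longrightarrow> F ` L k = L' k" and "0 < n"
  shows "edge_cluster n (snd G') L' (F ` e) = edge_cluster n (snd G) L e"
proof -
  let ?F' = "inv_into (fst G) F"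
  have inj: "inj_on F (fst G)" using iso by (simp add: graph_iso_def bij_betw_def)
  have iso': "graph_iso ?F' G' G" by (rule graph_iso_inv_into[OF iso edges])
  have e': "F ` e \<in> snd G'" "?F' ` F ` e = e"
    using iso e inv_into_image_cancel[OF inj, of e] edges by (simp_all add: graph_iso_def bij_betw_def subset_eq) blast+
  have reach: "(F u, F v) \<in> (adjacent (snd G' - {F ` e}))\<^sup>* \<longleftrightarrow>
      (u, v) \<in> (adjacent (snd G - {e}))\<^sup>*" if "u \<in> fst G" "v \<in> fst G" for u v
    using reach_iso[OF iso e, of u v] reach_iso[OF iso' e'(1), of "F u" "F v"] e'(2)
      inv_into_f_f[OF inj] that by auto
  have "(\<forall>u\<in>L' k. \<forall>v\<in>L' 0. (u, v) \<notin> (adjacent (snd G' - {F ` e}))\<^sup>*) \<longleftrightarrow>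
      (\<forall>u\<in>L k. \<forall>v\<in>L 0. (u, v) \<notin> (adjacent (snd G - {e}))\<^sup>*)" if "k < n" for k
    unfolding L(2)[OF that, symmetric] L(2)[OF \<open>0 < n\<close>, symmetric]
    using reach L(1)[OF that] L(1)[OF \<open>0 < n\<close>] by (simp add: subset_iff)
  then show ?thesis by (auto simp: edge_cluster_def)
qed

section \<open>Labelled trees are determined by their clusters\<close>

definition leaf :: "'v labelled_graph \<Rightarrow> nat \<Rightarrow> 'v"
  where "leaf T k = (THE v. v \<in> lam T k \<and> v \<in> leaves (gr T))"

text \<open>The map from a leaf to its edge is onto the unbounded edges, and there are
  \<open>n\<close> of both because \<open>lam T\<close> enumerates the unbounded edges. So it is
  injective, every unbounded edge contains just one leaf, and \<open>leaf\<close> is well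
  defined.\<close>

lemma leaf_labelled_tree_labelled_tree:
  assumes T: "labelled_tree n T" and n: "0 < n"
  shows "leaf_labelled_tree (fst (gr T)) (snd (gr T)) (leaf T) n (lam T)"
proof -
  let ?L = "leaves (gr T)" and ?U = "unbounded_edges (gr T)"
  define pe where "pe v = (THE e. e \<in> edges_at (gr T) v)" for v
  have pe: "e \<in> edges_at (gr T) v \<longleftrightarrow> e = pe v" if "v \<in> ?L" for v e
  proof -
    have "card (edges_at (gr T) v) = 1" using that by (simp add: leaves_def degree_def)
    then obtain x where "edges_at (gr T) v = {x}" by (rule card_1_singletonE)
    then show ?thesis by (simp add: pe_def)
  qed
  have lam: "bij_betw (lam T) {..<n} ?U" and card_L: "card ?L = n"
    using T by (simp_all add: labelled_tree_def)
  have mem: "e = pe v" if "v \<in> ?L" "e \<in> snd (gr T)" "v \<in> e" for e v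
    using pe[OF that(1)] that by (auto simp: edges_at_def)
  have pe_mem: "pe v \<in> ?U" "v \<in> pe v" if "v \<in> ?L" for v
    using pe[OF that, of "pe v"] that by (auto simp: edges_at_def unbounded_edges_def)
  have surj: "pe ` ?L = ?U"
    using pe_mem mem by (fastforce simp: unbounded_edges_def)
  have "card ?U = n" using bij_betw_same_card[OF lam] by simp
  then have "card ?L = card (pe ` ?L)" using card_L surj by simp
  moreover have fin: "finite ?L" using card_L n card_gt_0_iff by force
  ultimately have inj: "inj_on pe ?L" by (simp add: eq_card_imp_inj_on)
  have leaf: "leaf T k \<in> lam T k" "leaf T k \<in> ?L" "pe (leaf T k) = lam T k" if "k < n" for k
  proof -
    have "lam T k \<in> ?U" using lam that by (auto simp: bij_betw_def)
    then obtain v where v: "v \<in> ?L" "v \<in> lam T k" "lam T k \<in> snd (gr T)"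
      by (auto simp: unbounded_edges_def)
    have "leaf T k = v"
      unfolding leaf_def using v mem inj by (intro the_equality) (auto simp: inj_on_def)
    then show "leaf T k \<in> lam T k" "leaf T k \<in> ?L" "pe (leaf T k) = lam T k"
      using v mem by auto
  qed
  have "bij_betw (leaf T) {..<n} ?L"
    unfolding bij_betw_def
  proof
    show "inj_on (leaf T) {..<n}"
    proof (rule inj_onI)
      fix j k assume jk: "j \<in> {..<n}" "k \<in> {..<n}" "leaf T j = leaf T k"
      then have "lam T j = lam T k" using leaf(3)[of j] leaf(3)[of k] by simp
      then show "j = k" using lam jk by (auto simp: bij_betw_def dest: inj_onD)
    qed
    show "leaf T ` {..<n} = ?L"
    proof (intro equalityI subsetI)
      fix v assume v: "v \<in> ?L"
      then have "pe v \<in> lam T ` {..<n}"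
        using pe_mem(1)[OF v] lam by (simp add: bij_betw_def)
      then obtain k where k: "k < n" "pe v = lam T k" by auto
      then have "leaf T k = v" using leaf(2,3)[OF k(1)] v by (intro inj_onD[OF inj]) simp_all
      then show "v \<in> leaf T ` {..<n}" using k by auto
    qed (use leaf in auto)
  qed
  moreover have "lam T k \<in> snd (gr T)" if "k < n" for k
    using lam that by (auto simp: bij_betw_def unbounded_edges_def)
  moreover have "leaf T 0 \<in> fst (gr T)" using leaf(2)[OF n] by (simp add: leaves_def)
  ultimately show ?thesis
    using T n leaf by unfold_locales (auto simp: labelled_tree_def)
qed

text \<open>Written with \<open>edge_cluster\<close> rather than \<open>cluster\<close>: it mentions
  only labelled edges, so invariance under isomorphism is immediate from
  \<open>edge_cluster_iso\<close>.\<close>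

definition bnd_cluster :: "nat \<Rightarrow> 'v labelled_graph \<Rightarrow> nat \<Rightarrow> nat set"
  where "bnd_cluster n T i = edge_cluster n (snd (gr T)) (lam T) (bnd T i)"

lemma labelled_tree_edges:
  assumes "labelled_tree n T"
  shows "i < n - 3 \<Longrightarrow> bnd T i \<in> snd (gr T)" "k < n \<Longrightarrow> lam T k \<in> snd (gr T)"
    "i < n - 3 \<Longrightarrow> bnd T i \<notin> lam T ` {..<n}"
    "snd (gr T) = lam T ` {..<n} \<union> bnd T ` {..<n - 3}"
    "inj_on (bnd T) {..<n - 3}"
proof -
  have b: "bij_betw (lam T) {..<n} (unbounded_edges (gr T))"
      "bij_betw (bnd T) {..<n - 3} (bounded_edges (gr T))"
    using assms by (auto simp: labelled_tree_def)
  then show "i < n - 3 \<Longrightarrow> bnd T i \<in> snd (gr T)" "k < n \<Longrightarrow> lam T k \<in> snd (gr T)"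
    "i < n - 3 \<Longrightarrow> bnd T i \<notin> lam T ` {..<n}" "inj_on (bnd T) {..<n - 3}"
    by (auto simp: bij_betw_def unbounded_edges_def bounded_edges_def)
  have "snd (gr T) = unbounded_edges (gr T) \<union> bounded_edges (gr T)"
    by (auto simp: unbounded_edges_def bounded_edges_def)
  then show "snd (gr T) = lam T ` {..<n} \<union> bnd T ` {..<n - 3}"
    using b by (simp add: bij_betw_def)
qed

lemma bnd_cluster_eq:
  assumes "labelled_tree n T" "0 < n" "i < n - 3"
  shows "bnd_cluster n T i = leaf_labelled_tree.cluster (fst (gr T)) (snd (gr T)) (leaf T) n (bnd T i)"
proof -
  interpret leaf_labelled_tree "fst (gr T)" "snd (gr T)" "leaf T" n "lam T"
    by (rule leaf_labelled_tree_labelled_tree) fact+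
  show ?thesis
    using edge_cluster_eq labelled_tree_edges(1,3)[OF assms(1,3)] by (simp add: bnd_cluster_def)
qed

lemma inj_on_bnd_cluster:
  assumes "labelled_tree n T" "0 < n"
  shows "inj_on (bnd_cluster n T) {..<n - 3}"
proof (rule inj_onI)
  interpret leaf_labelled_tree "fst (gr T)" "snd (gr T)" "leaf T" n "lam T"
    by (rule leaf_labelled_tree_labelled_tree) fact+
  fix i j assume ij: "i \<in> {..<n - 3}" "j \<in> {..<n - 3}" "bnd_cluster n T i = bnd_cluster n T j"
  then have "cluster (bnd T i) = cluster (bnd T j)" using bnd_cluster_eq[OF assms] by simp
  then have "bnd T i = bnd T j"
    using cluster_eq_iff labelled_tree_edges(1)[OF assms(1)] ij by simp
  then show "i = j" using labelled_tree_edges(5)[OF assms(1)] ij by (simp add: inj_on_eq_iff)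
qed

lemma labelled_tree_graph: "labelled_tree n T \<Longrightarrow> snd (gr T) \<subseteq> Pow (fst (gr T))"
  by (intro is_graph_edges) (simp add: labelled_tree_def tree_graph_def)

lemma bnd_cluster_cong:
  assumes "(T, T') \<in> labelled_iso_rel n" "0 < n" "i < n - 3"
  shows "bnd_cluster n T i = bnd_cluster n T' i"
proof -
  obtain F where F: "labelled_tree n T" "graph_iso F (gr T) (gr T')"
      "\<And>k. k < n \<Longrightarrow> F ` lam T k = lam T' k" "F ` bnd T i = bnd T' i"
    using assms by (auto simp: labelled_iso_rel_def)
  note T = labelled_tree_edges(1,2)[OF F(1)] labelled_tree_graph[OF F(1)]
  show ?thesis
    unfolding bnd_cluster_def F(4)[symmetric]
    by (rule edge_cluster_iso[symmetric, OF F(2) T(3) T(1)]) (use T(2,3) F(3) assms in auto)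
qed

section \<open>Isomorphisms between degenerations\<close>

lemma degenerate_simps:
  "gr (degenerate n T p) = contract (bnd T ` {i. i < n - 3 \<and> p i = 0}) (gr T)"
  "lam (degenerate n T p) k = contract_vertex (bnd T ` {i. i < n - 3 \<and> p i = 0}) ` lam T k"
  "bnd (degenerate n T p) i = contract_vertex (bnd T ` {i. i < n - 3 \<and> p i = 0}) ` bnd T i"
  "surv (degenerate n T p) = {i. i < n - 3 \<and> 0 < p i}"
  "len (degenerate n T p) = p"
  by (simp_all add: degenerate_def Let_def)

lemma degenerate_edges:
  assumes T: "labelled_tree n T" and p: "p \<in> orthant (n - 3)"
  defines "S \<equiv> bnd T ` {i. i < n - 3 \<and> p i = 0}"
  shows "S \<subseteq> snd (gr T)" "snd (gr T) - S = lam T ` {..<n} \<union> bnd T ` {i. i < n - 3 \<and> 0 < p i}"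
proof -
  note e = labelled_tree_edges[OF T]
  show "S \<subseteq> snd (gr T)" using e(1) by (auto simp: S_def)
  have nonneg: "0 \<le> p i" if "i < n - 3" for i using p that by (simp add: orthant_def)
  have "bnd T i \<notin> S" if "i < n - 3" "0 < p i" for i
    using e(5) that by (auto simp: S_def inj_on_eq_iff)
  moreover have "bnd T i \<in> S" if "i < n - 3" "\<not> 0 < p i" for i
    using nonneg that by (force simp: S_def)
  moreover have "lam T k \<notin> S" if "k < n" for k
    using e(3) that by (force simp: S_def)
  ultimately show "snd (gr T) - S = lam T ` {..<n} \<union> bnd T ` {i. i < n - 3 \<and> 0 < p i}"
    unfolding e(4) by blast
qed

text \<open>An isomorphism preserving the labelled pendant edges preserves
  \<open>edge_cluster\<close>, and contraction does not change it. As pendant edges already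
  correspond to pendant edges, injectivity on edges makes the surviving bounded edges correspond to
  each other.\<close>

lemma degenerate_iso_clusters:
  assumes T: "labelled_tree n T" "labelled_tree n T'" and n: "0 < n"
    and p: "p \<in> orthant (n - 3)" and q: "q \<in> orthant (n - 3)"
    and F: "graph_iso F (gr (degenerate n T p)) (gr (degenerate n T' q))"
    and "\<forall>k<n. F ` lam (degenerate n T p) k = lam (degenerate n T' q) k"
  shows "\<And>i j. \<lbrakk>i \<in> surv (degenerate n T p); j \<in> surv (degenerate n T' q);
        F ` bnd (degenerate n T p) i = bnd (degenerate n T' q) j\<rbrakk> \<Longrightarrow>
      bnd_cluster n T i = bnd_cluster n T' j"
    and "\<And>i. i \<in> surv (degenerate n T p) \<Longrightarrow> \<exists>j\<in>surv (degenerate n T' q).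
      F ` bnd (degenerate n T p) i = bnd (degenerate n T' q) j"
    and "\<And>j. j \<in> surv (degenerate n T' q) \<Longrightarrow> \<exists>i\<in>surv (degenerate n T p).
      F ` bnd (degenerate n T p) i = bnd (degenerate n T' q) j"
proof -
  have lam: "F ` lam (degenerate n T p) k = lam (degenerate n T' q) k" if "k < n" for k
    using assms that by blast
  define S where "S = bnd T ` {i. i < n - 3 \<and> p i = 0}"
  define S' where "S' = bnd T' ` {i. i < n - 3 \<and> q i = 0}"
  note simps = degenerate_simps S_def[symmetric] S'_def[symmetric]
  interpret T: leaf_labelled_tree "fst (gr T)" "snd (gr T)" "leaf T" n "lam T"
    by (rule leaf_labelled_tree_labelled_tree) fact+
  interpret T': leaf_labelled_tree "fst (gr T')" "snd (gr T')" "leaf T'" n "lam T'"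
    by (rule leaf_labelled_tree_labelled_tree) fact+
  note S = degenerate_edges[OF T(1) p, folded S_def] and S' = degenerate_edges[OF T(2) q, folded S'_def]
  have G: "gr (degenerate n T p) = contract S (fst (gr T), snd (gr T))"
      "gr (degenerate n T' q) = contract S' (fst (gr T'), snd (gr T'))"
    by (simp_all add: simps)
  have edges: "snd (gr (degenerate n T p)) =
      (\<lambda>e. contract_vertex S ` e) ` (lam T ` {..<n} \<union> bnd T ` {i. i < n - 3 \<and> 0 < p i})"
    "snd (gr (degenerate n T' q)) =
      (\<lambda>e. contract_vertex S' ` e) ` (lam T' ` {..<n} \<union> bnd T' ` {i. i < n - 3 \<and> 0 < q i})"
    by (simp_all add: simps contract_def S(2) S'(2))
  have bnd_mem: "bnd T i \<in> snd (gr T) - S" if "i < n - 3" "0 < p i" for i using S that by blast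
  have bnd_mem': "bnd T' i \<in> snd (gr T') - S'" if "i < n - 3" "0 < q i" for i using S' that by blast
  have lam_mem: "lam T k \<in> snd (gr T) - S" if "k < n" for k using S that by blast
  have lam_mem': "lam T' k \<in> snd (gr T') - S'" if "k < n" for k using S' that by blast
  have bij: "bij_betw (image F) (snd (gr (degenerate n T p))) (snd (gr (degenerate n T' q)))"
    using F by (simp add: graph_iso_def)
  have Pow: "snd (gr (degenerate n T p)) \<subseteq> Pow (fst (gr (degenerate n T p)))"
    unfolding G by (intro contract_edges) (simp add: labelled_tree_graph[OF T(1)])
  show "bnd_cluster n T i = bnd_cluster n T' j"
    if ij: "i \<in> surv (degenerate n T p)" "j \<in> surv (degenerate n T' q)"
      and eq: "F ` bnd (degenerate n T p) i = bnd (degenerate n T' q) j" for i j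
  proof -
    have i: "i < n - 3" "0 < p i" and j: "j < n - 3" "0 < q j"
      using ij by (simp_all add: simps)
    have "bnd (degenerate n T p) i \<in> snd (gr (degenerate n T p))"
      unfolding edges using i by (auto simp: simps)
    then have "edge_cluster n (snd (gr (degenerate n T' q))) (lam (degenerate n T' q))
        (F ` bnd (degenerate n T p) i) =
      edge_cluster n (snd (gr (degenerate n T p))) (lam (degenerate n T p))
        (bnd (degenerate n T p) i)"
    proof (rule edge_cluster_iso[OF F Pow _ _ lam n])
      fix k assume "k < n"
      then have "lam (degenerate n T p) k \<in> snd (gr (degenerate n T p))"
        unfolding edges by (auto simp: simps)
      then show "lam (degenerate n T p) k \<subseteq> fst (gr (degenerate n T p))" using Pow by blast
    qed
    moreover have "lam (degenerate n T p) = (\<lambda>k. contract_vertex S ` lam T k)"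
      "lam (degenerate n T' q) = (\<lambda>k. contract_vertex S' ` lam T' k)"
      by (auto simp: simps)
    ultimately show ?thesis
      using T.edge_cluster_contract[OF S(1) bnd_mem[OF i], of n "lam T"]
        T'.edge_cluster_contract[OF S'(1) bnd_mem'[OF j], of n "lam T'"]
      unfolding eq unfolding bnd_cluster_def G by (simp add: simps)
  qed
  show "\<exists>j\<in>surv (degenerate n T' q). F ` bnd (degenerate n T p) i = bnd (degenerate n T' q) j"
    if "i \<in> surv (degenerate n T p)" for i
  proof -
    have i: "i < n - 3" "0 < p i" using that by (simp_all add: simps)
    have mem: "bnd (degenerate n T p) i \<in> snd (gr (degenerate n T p))"
      unfolding edges using i by (auto simp: simps)
    have "F ` bnd (degenerate n T p) i \<noteq> lam (degenerate n T' q) k" if k: "k < n" for k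
    proof
      assume "F ` bnd (degenerate n T p) i = lam (degenerate n T' q) k"
      then have "F ` bnd (degenerate n T p) i = F ` lam (degenerate n T p) k" using lam k by simp
      moreover have "lam (degenerate n T p) k \<in> snd (gr (degenerate n T p))"
        unfolding edges using k by (auto simp: simps)
      ultimately have "bnd (degenerate n T p) i = lam (degenerate n T p) k"
        using inj_onD[OF bij_betw_imp_inj_on[OF bij]] mem by blast
      then have "bnd T i = lam T k"
        using T.contract_edge_inj[OF S(1) bnd_mem[OF i] lam_mem[OF k]] by (simp add: simps)
      then show False using labelled_tree_edges(3)[OF T(1)] i k by blast
    qed
    moreover have "F ` bnd (degenerate n T p) i \<in> snd (gr (degenerate n T' q))"
      using bij mem by (auto simp: bij_betw_def)
    ultimately show ?thesis unfolding edges by (auto simp: simps)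
  qed
  show "\<exists>i\<in>surv (degenerate n T p). F ` bnd (degenerate n T p) i = bnd (degenerate n T' q) j"
    if "j \<in> surv (degenerate n T' q)" for j
  proof -
    have j: "j < n - 3" "0 < q j" using that by (simp_all add: simps)
    have "bnd (degenerate n T' q) j \<in> snd (gr (degenerate n T' q))"
      unfolding edges using j by (auto simp: simps)
    then obtain x where x: "x \<in> snd (gr (degenerate n T p))" "F ` x = bnd (degenerate n T' q) j"
      using bij by (metis bij_betw_imp_surj_on imageE)
    have "x \<noteq> lam (degenerate n T p) k" if k: "k < n" for k
    proof
      assume "x = lam (degenerate n T p) k"
      then have "lam (degenerate n T' q) k = bnd (degenerate n T' q) j" using lam k x by simp
      then have "lam T' k = bnd T' j"
        using T'.contract_edge_inj[OF S'(1) lam_mem'[OF k] bnd_mem'[OF j]] by (simp add: simps)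
      then show False using labelled_tree_edges(3)[OF T(2) j(1)] k by force
    qed
    then show ?thesis using x unfolding edges by (auto simp: simps)
  qed
qed

text \<open>Pendant edges have the same clusters in every tree, so the hypothesis on bounded edges
  makes the cluster sets of all surviving edges equal.\<close>

lemma degenerate_iso_ex:
  assumes T: "labelled_tree n T" "labelled_tree n T'" and n: "0 < n"
    and p: "p \<in> orthant (n - 3)" and q: "q \<in> orthant (n - 3)"
    and eq: "bnd_cluster n T ` {i. i < n - 3 \<and> 0 < p i} = bnd_cluster n T' ` {i. i < n - 3 \<and> 0 < q i}"
  obtains F where "graph_iso F (gr (degenerate n T p)) (gr (degenerate n T' q))"
    "\<forall>k<n. F ` lam (degenerate n T p) k = lam (degenerate n T' q) k"
proof -
  define S where "S = bnd T ` {i. i < n - 3 \<and> p i = 0}"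
  define S' where "S' = bnd T' ` {i. i < n - 3 \<and> q i = 0}"
  note simps = degenerate_simps S_def[symmetric] S'_def[symmetric]
  have TT: "leaf_labelled_tree (fst (gr T)) (snd (gr T)) (leaf T) n (lam T)"
      "leaf_labelled_tree (fst (gr T')) (snd (gr T')) (leaf T') n (lam T')"
    using leaf_labelled_tree_labelled_tree T n by blast+
  interpret T: leaf_labelled_tree "fst (gr T)" "snd (gr T)" "leaf T" n "lam T" by fact
  interpret T': leaf_labelled_tree "fst (gr T')" "snd (gr T')" "leaf T'" n "lam T'" by fact
  note S = degenerate_edges[OF T(1) p, folded S_def] and S' = degenerate_edges[OF T(2) q, folded S'_def]
  have pendant: "T.cluster (lam T k) = T'.cluster (lam T' k)" if "k < n" for k
    using that T.cluster_pendant T'.cluster_pendant T.cluster_pendant_0 T'.cluster_pendant_0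
    by (cases "k = 0") auto
  have "T.cluster ` bnd T ` {i. i < n - 3 \<and> 0 < p i} = bnd_cluster n T ` {i. i < n - 3 \<and> 0 < p i}"
    "T'.cluster ` bnd T' ` {i. i < n - 3 \<and> 0 < q i} = bnd_cluster n T' ` {i. i < n - 3 \<and> 0 < q i}"
    unfolding image_image using bnd_cluster_eq T n by (auto intro!: image_cong)
  moreover have "T.cluster ` lam T ` {..<n} = T'.cluster ` lam T' ` {..<n}"
    unfolding image_image using pendant by (intro image_cong) auto
  ultimately have "T.cluster ` (snd (gr T) - S) = T'.cluster ` (snd (gr T') - S')"
    unfolding S(2) S'(2) image_Un using eq by simp
  from contract_iso_of_clusters[OF TT S(1) S'(1) this] obtain F where
    F: "graph_iso F (contract S (fst (gr T), snd (gr T))) (contract S' (fst (gr T'), snd (gr T')))"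
     "\<And>e e'. \<lbrakk>e \<in> snd (gr T) - S; e' \<in> snd (gr T') - S'; T.cluster e = T'.cluster e'\<rbrakk> \<Longrightarrow>
      F ` contract_vertex S ` e = contract_vertex S' ` e'" by blast
  show thesis
  proof
    show "graph_iso F (gr (degenerate n T p)) (gr (degenerate n T' q))"
      using F(1) by (simp add: simps)
    show "\<forall>k<n. F ` lam (degenerate n T p) k = lam (degenerate n T' q) k"
      using F(2)[of "lam T k" "lam T' k" for k] S(2) S'(2) pendant by (simp add: simps)
  qed
qed

section \<open>Identified points\<close>

text \<open>By \<open>bnd_cluster_cong\<close> the representative chosen here is immaterial for the
  indices below \<open>n - 3\<close>.\<close>

definition type_cluster :: "nat \<Rightarrow> nat labelled_graph set \<Rightarrow> nat \<Rightarrow> nat set"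
  where "type_cluster n G = bnd_cluster n (SOME T. T \<in> G)"

lemma labelled_types_nonempty: "G \<in> labelled_types n \<Longrightarrow> \<exists>T. T \<in> G"
proof -
  have "(T, T) \<in> labelled_iso_rel n" if "labelled_tree n T" for T
    using that by (auto simp: labelled_iso_rel_def graph_iso_def intro!: exI[of _ id])
  then show "G \<in> labelled_types n \<Longrightarrow> \<exists>T. T \<in> G"
    by (auto simp: labelled_types_def quotient_def)
qed

lemma labelled_types_cluster:
  assumes "G \<in> labelled_types n" "T \<in> G" "0 < n"
  shows "labelled_tree n T" "i < n - 3 \<Longrightarrow> bnd_cluster n T i = type_cluster n G i"
proof -
  obtain T0 where T0: "G = labelled_iso_rel n `` {T0}"
    using assms by (auto simp: labelled_types_def quotient_def)
  have "(SOME T. T \<in> G) \<in> G" using assms(2) by (rule someI)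
  then have rel: "(T0, SOME T. T \<in> G) \<in> labelled_iso_rel n" "(T0, T) \<in> labelled_iso_rel n"
    using T0 assms(2) by simp_all
  show "labelled_tree n T" using rel(2) by (simp add: labelled_iso_rel_def)
  show "i < n - 3 \<Longrightarrow> bnd_cluster n T i = type_cluster n G i"
    using bnd_cluster_cong[OF rel(1) assms(3)] bnd_cluster_cong[OF rel(2) assms(3)]
    by (simp add: type_cluster_def)
qed

text \<open>The name under which a coordinate is recognised in another orthant. It consists of data
  preserved by identification, unlike the index \<open>i\<close>.\<close>

definition edge_label ::
    "nat \<Rightarrow> nat labelled_graph set \<times> (nat \<Rightarrow> nat multiset) \<Rightarrow> nat \<Rightarrow> nat set \<times> nat multiset"
  where "edge_label n g i = (type_cluster n (fst g) i, snd g i)"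

lemma inj_on_edge_label:
  assumes "g \<in> acceptable_data d n \<sigma>" "0 < n"
  shows "inj_on (edge_label n g) {..<n - 3}"
proof (rule inj_onI)
  have G: "fst g \<in> labelled_types n" using assms by (auto simp: acceptable_data_def)
  then obtain T where T: "T \<in> fst g" using labelled_types_nonempty by blast
  note c = labelled_types_cluster[OF G T assms(2)]
  fix i j assume ij: "i \<in> {..<n - 3}" "j \<in> {..<n - 3}" "edge_label n g i = edge_label n g j"
  then have "bnd_cluster n T i = bnd_cluster n T j" using c(2) by (simp add: edge_label_def)
  then show "i = j" using inj_onD[OF inj_on_bnd_cluster[OF c(1) assms(2)]] ij(1,2) by blast
qed

text \<open>Zero coordinates are dropped because contracted edges leave no trace in the metric
  graph.\<close>

definition weights :: "nat \<Rightarrow> (nat \<Rightarrow> 'c) \<Rightarrow> (nat \<Rightarrow> real) \<Rightarrow> ('c \<times> real) set"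
  where "weights m b p = (\<lambda>i. (b i, p i)) ` {i. i < m \<and> 0 < p i}"

lemma topspace_D_space:
  "topspace (D_space d n \<sigma>) = acceptable_data d n \<sigma> \<times> orthant (n - 3)"
  by (auto simp: D_space_def orthant_def)

text \<open>The right-hand side compares values of one invariant. It follows that
  \<open>identified\<close> is an equivalence on the points of \<open>D\<close> and does not depend
  on the representatives of the types.\<close>

lemma identified_iff:
  assumes n: "0 < n"
  shows "((g, p), (g', q)) \<in> identified d n \<sigma> \<longleftrightarrow>
    g \<in> acceptable_data d n \<sigma> \<and> p \<in> orthant (n - 3) \<and>
    g' \<in> acceptable_data d n \<sigma> \<and> q \<in> orthant (n - 3) \<and>
    weights (n - 3) (edge_label n g) p = weights (n - 3) (edge_label n g') q"
    (is "_ \<longleftrightarrow> ?mem \<and> _ \<and> _ \<and> _ \<and> ?W = ?W'")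
proof
  assume "((g, p), (g', q)) \<in> identified d n \<sigma>"
  then obtain T T' F where TT: "T \<in> fst g" "T' \<in> fst g'"
    and mem: "g \<in> acceptable_data d n \<sigma>" "p \<in> orthant (n - 3)" "g' \<in> acceptable_data d n \<sigma>"
      "q \<in> orthant (n - 3)"
    and F: "metric_iso F (degenerate n T p) (degenerate n T' q)"
      "\<forall>k<n. F ` lam (degenerate n T p) k = lam (degenerate n T' q) k"
      "\<forall>i\<in>surv (degenerate n T p). \<forall>j\<in>surv (degenerate n T' q).
        F ` bnd (degenerate n T p) i = bnd (degenerate n T' q) j \<longrightarrow> snd g i = snd g' j"
    unfolding identified_def topspace_D_space Let_def by (cases g; cases g') auto
  have G: "fst g \<in> labelled_types n" "fst g' \<in> labelled_types n"
    using mem by (auto simp: acceptable_data_def)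
  note c = labelled_types_cluster[OF G(1) TT(1) n] and c' = labelled_types_cluster[OF G(2) TT(2) n]
  have iso: "graph_iso F (gr (degenerate n T p)) (gr (degenerate n T' q))"
    using F(1) by (simp add: metric_iso_def)
  note cl = degenerate_iso_clusters[OF c(1) c'(1) n mem(2,4) iso F(2)]
  have match: "(edge_label n g i, p i) = (edge_label n g' j, q j)"
    if "i \<in> surv (degenerate n T p)" "j \<in> surv (degenerate n T' q)"
      "F ` bnd (degenerate n T p) i = bnd (degenerate n T' q) j" for i j
  proof -
    have ij: "i < n - 3" "j < n - 3" using that(1,2) by (simp_all add: degenerate_simps(4))
    have "type_cluster n (fst g) i = type_cluster n (fst g') j"
      using cl(1)[OF that] c(2)[OF ij(1)] c'(2)[OF ij(2)] by simp
    moreover have "p i = q j"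
      using F(1) that unfolding metric_iso_def degenerate_simps(5) by blast
    moreover have "snd g i = snd g' j" using F(3) that by blast
    ultimately show ?thesis by (simp add: edge_label_def)
  qed
  have "?W \<subseteq> ?W'"
  proof
    fix x assume "x \<in> ?W"
    then obtain i where i: "i \<in> surv (degenerate n T p)" "x = (edge_label n g i, p i)"
      by (auto simp: weights_def degenerate_simps(4))
    obtain j where j: "j \<in> surv (degenerate n T' q)"
        "F ` bnd (degenerate n T p) i = bnd (degenerate n T' q) j"
      using cl(2)[OF i(1)] by blast
    then show "x \<in> ?W'"
      using match[OF i(1) j] i(2) by (auto simp: weights_def degenerate_simps(4))
  qed
  moreover have "?W' \<subseteq> ?W"
  proof
    fix x assume "x \<in> ?W'"
    then obtain j where j: "j \<in> surv (degenerate n T' q)" "x = (edge_label n g' j, q j)"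
      by (auto simp: weights_def degenerate_simps(4))
    obtain i where i: "i \<in> surv (degenerate n T p)"
        "F ` bnd (degenerate n T p) i = bnd (degenerate n T' q) j"
      using cl(3)[OF j(1)] by blast
    have "x = (edge_label n g i, p i)" using match[OF i(1) j(1) i(2)] j(2) by simp
    then show "x \<in> ?W" using i(1) by (auto simp: weights_def degenerate_simps(4))
  qed
  ultimately show "?mem \<and> p \<in> orthant (n - 3) \<and> g' \<in> acceptable_data d n \<sigma> \<and> q \<in> orthant (n - 3) \<and> ?W = ?W'"
    using mem by blast
next
  assume *: "?mem \<and> p \<in> orthant (n - 3) \<and> g' \<in> acceptable_data d n \<sigma> \<and> q \<in> orthant (n - 3) \<and> ?W = ?W'"
  then have mem: "g \<in> acceptable_data d n \<sigma>" "p \<in> orthant (n - 3)" "g' \<in> acceptable_data d n \<sigma>"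
      "q \<in> orthant (n - 3)" and W: "?W = ?W'" by simp_all
  have G: "fst g \<in> labelled_types n" "fst g' \<in> labelled_types n"
    using mem by (auto simp: acceptable_data_def)
  obtain T T' where TT: "T \<in> fst g" "T' \<in> fst g'" using G labelled_types_nonempty by metis
  note c = labelled_types_cluster[OF G(1) TT(1) n] and c' = labelled_types_cluster[OF G(2) TT(2) n]
  have "(fst \<circ> fst) ` ?W = bnd_cluster n T ` {i. i < n - 3 \<and> 0 < p i}"
    unfolding weights_def image_image using c(2) by (intro image_cong) (auto simp: edge_label_def)
  moreover have "(fst \<circ> fst) ` ?W' = bnd_cluster n T' ` {i. i < n - 3 \<and> 0 < q i}"
    unfolding weights_def image_image using c'(2) by (intro image_cong) (auto simp: edge_label_def)
  ultimately obtain F where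
    iso: "graph_iso F (gr (degenerate n T p)) (gr (degenerate n T' q))" and
    lam: "\<forall>k<n. F ` lam (degenerate n T p) k = lam (degenerate n T' q) k"
    using degenerate_iso_ex[OF c(1) c'(1) n mem(2,4)] W by metis
  \<comment> \<open>The isomorphism was obtained from clusters alone. It respects lengths and
    partitions because the edge of \<open>T'\<close> with the same triple has the same cluster as
    the image edge, and clusters are distinct within \<open>T'\<close>.\<close>
  have match: "p i = q j \<and> snd g i = snd g' j"
    if ij: "i \<in> surv (degenerate n T p)" "j \<in> surv (degenerate n T' q)"
      and eq: "F ` bnd (degenerate n T p) i = bnd (degenerate n T' q) j" for i j
  proof -
    have lt: "i < n - 3" "j < n - 3" "0 < p i" using ij by (simp_all add: degenerate_simps(4))
    have "bnd_cluster n T i = bnd_cluster n T' j"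
      using degenerate_iso_clusters(1)[OF c(1) c'(1) n mem(2,4) iso lam ij eq] .
    moreover have "(edge_label n g i, p i) \<in> ?W" using lt by (auto simp: weights_def)
    then have "(edge_label n g i, p i) \<in> ?W'" by (simp only: W)
    then obtain j' where j': "j' < n - 3" "edge_label n g i = edge_label n g' j'" "p i = q j'"
      by (auto simp: weights_def)
    ultimately have "bnd_cluster n T' j = bnd_cluster n T' j'"
      using c(2)[OF lt(1)] c'(2)[OF j'(1)] by (simp add: edge_label_def)
    then have "j = j'"
      using lt j'(1) by (intro inj_onD[OF inj_on_bnd_cluster[OF c'(1) n]]) auto
    then show ?thesis using j' by (simp add: edge_label_def)
  qed
  have "metric_iso F (degenerate n T p) (degenerate n T' q)"
    unfolding metric_iso_def degenerate_simps(5) using iso match by simp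
  moreover have "\<forall>i\<in>surv (degenerate n T p). \<forall>j\<in>surv (degenerate n T' q).
      F ` bnd (degenerate n T p) i = bnd (degenerate n T' q) j \<longrightarrow> snd g i = snd g' j"
    using match by simp
  ultimately have "\<exists>T\<in>fst g. \<exists>T'\<in>fst g'. \<exists>F. metric_iso F (degenerate n T p) (degenerate n T' q) \<and>
      (\<forall>k<n. F ` lam (degenerate n T p) k = lam (degenerate n T' q) k) \<and>
      (\<forall>i\<in>surv (degenerate n T p). \<forall>j\<in>surv (degenerate n T' q).
        F ` bnd (degenerate n T p) i = bnd (degenerate n T' q) j \<longrightarrow> snd g i = snd g' j)"
    using lam by (intro bexI[OF _ TT(1)] bexI[OF _ TT(2)] exI[of _ F] conjI)
  then show "((g, p), (g', q)) \<in> identified d n \<sigma>"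
    unfolding identified_def topspace_D_space Let_def using mem by (cases g; cases g') simp
qed

lemma H_proj_eq_iff:
  assumes n: "0 < n" and x: "g \<in> acceptable_data d n \<sigma>" "p \<in> orthant (n - 3)"
    and y: "g' \<in> acceptable_data d n \<sigma>" "q \<in> orthant (n - 3)"
  shows "H_proj d n \<sigma> (g, p) = H_proj d n \<sigma> (g', q) \<longleftrightarrow>
    weights (n - 3) (edge_label n g) p = weights (n - 3) (edge_label n g') q"
proof
  assume eq: "H_proj d n \<sigma> (g, p) = H_proj d n \<sigma> (g', q)"
  have "(g', q) \<in> H_proj d n \<sigma> (g', q)" using y by (simp add: H_proj_def identified_iff[OF n])
  then have "((g, p), (g', q)) \<in> identified d n \<sigma>" unfolding eq[symmetric] by (simp add: H_proj_def)
  then show "weights (n - 3) (edge_label n g) p = weights (n - 3) (edge_label n g') q"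
    unfolding identified_iff[OF n] by blast
next
  assume "weights (n - 3) (edge_label n g) p = weights (n - 3) (edge_label n g') q"
  then show "H_proj d n \<sigma> (g, p) = H_proj d n \<sigma> (g', q)"
    using x y by (auto simp: H_proj_def identified_iff[OF n])
qed

section \<open>Matching coordinates\<close>

definition matched :: "nat \<Rightarrow> (nat \<Rightarrow> 'c) \<Rightarrow> (nat \<Rightarrow> 'c) \<Rightarrow> nat set"
  where "matched m b b' = {i. i < m \<and> b i \<in> b' ` {..<m}}"

text \<open>The partial bijection between coordinates with equal label, completed by 0. Copying
  coordinates makes sense for all functions, not only for points of the orthant, so the map is
  linear and continuous everywhere and also acts on affine hulls and lattice points.\<close>

definition transport ::
    "nat \<Rightarrow> (nat \<Rightarrow> 'c) \<Rightarrow> (nat \<Rightarrow> 'c) \<Rightarrow> (nat \<Rightarrow> real) \<Rightarrow> nat \<Rightarrow> real"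
  where "transport m b b' p =
    (\<lambda>j. if j \<in> matched m b' b then p (inv_into {..<m} b (b' j)) else 0)"

lemma transport_match:
  assumes "inj_on b {..<m}" "i < m" "j < m" "b i = b' j"
  shows "transport m b b' p j = p i"
proof -
  have "inv_into {..<m} b (b' j) = i" using assms by (metis inv_into_f_f lessThan_iff)
  moreover have "b' j \<in> b ` {..<m}" using assms by (metis imageI lessThan_iff)
  ultimately show ?thesis using assms(3) by (simp add: transport_def matched_def)
qed

lemma transport_unmatched: "j \<notin> matched m b' b \<Longrightarrow> transport m b b' p j = 0"
  by (simp add: transport_def)

lemma matchedE:
  assumes "j \<in> matched m b' b"
  obtains i where "i < m" "j < m" "b i = b' j" "i \<in> matched m b b'"
  using assms by (force simp: matched_def)

lemma transport_transport:
  assumes inj: "inj_on b {..<m}" "inj_on b' {..<m}"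
    and p: "\<And>i. i \<notin> matched m b b' \<Longrightarrow> p i = 0"
  shows "transport m b' b (transport m b b' p) = p"
proof
  fix i show "transport m b' b (transport m b b' p) i = p i"
  proof (cases "i \<in> matched m b b'")
    case True
    then obtain j where "j < m" "i < m" "b' j = b i" by (rule matchedE)
    then show ?thesis
      using transport_match[OF inj(2), of j i b "transport m b b' p"]
        transport_match[OF inj(1), of i j b' p] by simp
  qed (simp add: transport_unmatched p)
qed

lemma transport_orthant:
  assumes "inj_on b {..<m}" "p \<in> orthant m"
  shows "transport m b b' p \<in> orthant m"
proof -
  have "0 \<le> transport m b b' p j" for j
  proof (cases "j \<in> matched m b' b")
    case True
    then obtain i where "i < m" "j < m" "b i = b' j" by (rule matchedE)
    then show ?thesis
      using transport_match[OF assms(1), of i j b' p] assms(2) by (simp add: orthant_def)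
  qed (simp add: transport_unmatched)
  moreover have "transport m b b' p j = 0" if "m \<le> j" for j
    using that by (intro transport_unmatched) (simp add: matched_def)
  ultimately show ?thesis by (simp add: orthant_def topspace_Euclidean_space)
qed

text \<open>A positive coordinate has a partner with the same label and value, unique by
  injectivity, and a coordinate without partner must vanish. Identification thereby becomes the
  graph of a map on a coordinate face, the form in which all gluing arguments use it.\<close>

lemma weights_eq_iff:
  assumes inj: "inj_on b {..<m}" "inj_on b' {..<m}" and p: "p \<in> orthant m" and q: "q \<in> orthant m"
  shows "weights m b p = weights m b' q \<longleftrightarrow>
    (\<forall>i. i \<notin> matched m b b' \<longrightarrow> p i = 0) \<and> q = transport m b b' p"
proof
  assume eq: "weights m b p = weights m b' q"
  have pq: "\<exists>j<m. b' j = b i \<and> q j = p i" if "i < m" "0 < p i" for i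
  proof -
    have "(b i, p i) \<in> weights m b p" using that by (auto simp: weights_def)
    then have "(b i, p i) \<in> weights m b' q" by (simp only: eq)
    then show ?thesis by (auto simp: weights_def)
  qed
  have qp: "\<exists>i<m. b i = b' j \<and> p i = q j" if "j < m" "0 < q j" for j
  proof -
    have "(b' j, q j) \<in> weights m b' q" using that by (auto simp: weights_def)
    then have "(b' j, q j) \<in> weights m b p" by (simp only: eq)
    then show ?thesis by (auto simp: weights_def)
  qed
  have p0: "0 \<le> p i" for i using p by (cases "i < m") (auto simp: orthant_def topspace_Euclidean_space)
  have q0: "0 \<le> q i" for i using q by (cases "i < m") (auto simp: orthant_def topspace_Euclidean_space)
  have p_out: "p i = 0" and q_out: "q i = 0" if "m \<le> i" for i
    using p q that by (auto simp: orthant_def topspace_Euclidean_space)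
  have unm: "p i = 0" if "i \<notin> matched m b b'" for i
  proof (rule ccontr)
    assume "p i \<noteq> 0"
    then have "0 < p i" "i < m" using p0[of i] p_out[of i] by (auto simp: not_le[symmetric])
    then obtain j where "j < m" "b' j = b i" using pq by blast
    then have "b i \<in> b' ` {..<m}" by (metis imageI lessThan_iff)
    then show False using that \<open>i < m\<close> by (simp add: matched_def)
  qed
  have "q j = transport m b b' p j" for j
  proof (cases "j \<in> matched m b' b")
    case True
    then obtain i where i: "i < m" "j < m" "b i = b' j" by (rule matchedE)
    have "q j = p i"
    proof (cases "0 < p i")
      case True
      then obtain j' where j': "j' < m" "b' j' = b i" "q j' = p i" using pq i by blast
      then have "j' = j" using inj(2) i by (intro inj_onD[OF inj(2)]) auto
      then show ?thesis using j' by simp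
    next
      case False
      \<comment> \<open>A zero coordinate is invisible in \<open>weights\<close>, so its partner is
        treated from the other side: a positive \<open>q j\<close> would come from a positive
        coordinate labelled like \<open>i\<close>, that is, from \<open>i\<close> itself.\<close>
      have "\<not> 0 < q j"
      proof
        assume "0 < q j"
        then obtain i' where i': "i' < m" "b i' = b' j" "p i' = q j" using qp i by blast
        then have "i' = i" using i by (intro inj_onD[OF inj(1)]) auto
        then show False using i' False \<open>0 < q j\<close> by simp
      qed
      then show ?thesis using False p0[of i] q0[of j] by linarith
    qed
    then show ?thesis using transport_match[of b m i j b' p, OF inj(1) i] by simp
  next
    case False
    have "\<not> 0 < q j"
    proof
      assume "0 < q j"
      moreover have "j < m" using q_out[of j] \<open>0 < q j\<close> by (cases "j < m") auto
      ultimately obtain i where "i < m" "b i = b' j" using qp by blast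
      then have "b' j \<in> b ` {..<m}" by (metis imageI lessThan_iff)
      then show False using False \<open>j < m\<close> by (simp add: matched_def)
    qed
    then show ?thesis using False q0[of j] by (simp add: transport_unmatched)
  qed
  then show "(\<forall>i. i \<notin> matched m b b' \<longrightarrow> p i = 0) \<and> q = transport m b b' p"
    using unm by blast
next
  assume *: "(\<forall>i. i \<notin> matched m b b' \<longrightarrow> p i = 0) \<and> q = transport m b b' p"
  show "weights m b p = weights m b' q"
  proof (intro equalityI subsetI)
    fix x assume "x \<in> weights m b p"
    then obtain i where i: "i < m" "0 < p i" "x = (b i, p i)" by (auto simp: weights_def)
    then have "i \<in> matched m b b'" using * by force
    then obtain j where j: "j < m" "b' j = b i" by (rule matchedE)
    then have "q j = p i" using * transport_match[OF inj(1) i(1) j(1)] by simp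
    then show "x \<in> weights m b' q" using i j by (force simp: weights_def)
  next
    fix x assume "x \<in> weights m b' q"
    then obtain j where j: "j < m" "0 < q j" "x = (b' j, q j)" by (auto simp: weights_def)
    then have "j \<in> matched m b' b" using * transport_unmatched[of j m b' b p] by force
    then obtain i where i: "i < m" "b i = b' j" by (rule matchedE)
    then have "q j = p i" using * transport_match[OF inj(1) i(1) j(1)] by simp
    then show "x \<in> weights m b p" using i j by (force simp: weights_def)
  qed
qed

lemma continuous_transport: "continuous_on UNIV (transport m b b')"
proof (rule continuous_on_coordinatewise_then_product)
  fix j show "continuous_on UNIV (\<lambda>p. transport m b b' p j)"
    by (cases "j \<in> matched m b' b") (auto simp: transport_def intro: continuous_on_product_coordinates)
qed

lemma transport_linear:
  "transport m b b' (s *\<^sub>R x + t *\<^sub>R y) = s *\<^sub>R transport m b b' x + t *\<^sub>R transport m b b' y"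
  by (auto simp: transport_def scaleR_fun_def fun_eq_iff)

section \<open>Faces of the orthant\<close>

definition coord_face :: "nat \<Rightarrow> nat set \<Rightarrow> (nat \<Rightarrow> real) set"
  where "coord_face m I = {x \<in> orthant m. \<forall>i. i \<notin> I \<longrightarrow> x i = 0}"

lemma orthant_iff: "x \<in> orthant m \<longleftrightarrow> (\<forall>i\<ge>m. x i = 0) \<and> (\<forall>i. 0 \<le> x i)"
proof -
  have "0 \<le> x i" if "\<forall>i\<ge>m. x i = 0" "\<forall>i<m. 0 \<le> x i" for i
    using that by (cases "i < m") auto
  then show ?thesis by (auto simp: orthant_def topspace_Euclidean_space)
qed

lemma coord_face_iff:
  assumes "I \<subseteq> {..<m}"
  shows "x \<in> coord_face m I \<longleftrightarrow> (\<forall>i. i \<notin> I \<longrightarrow> x i = 0) \<and> (\<forall>i. 0 \<le> x i)"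
  using assms by (auto simp: coord_face_def orthant_iff subset_iff not_less[symmetric])

lemma convex_orthant: "convex (orthant m)"
  by (auto simp: convex_def orthant_iff scaleR_fun_def)

lemma coord_face_of: "coord_face m I face_of orthant m"
  unfolding face_of_def
proof (intro conjI ballI impI)
  show "coord_face m I \<subseteq> orthant m" by (auto simp: coord_face_def)
  show "convex (coord_face m I)"
    using convex_orthant[of m] by (auto simp: convex_def coord_face_def scaleR_fun_def)
  fix a b x assume ab: "a \<in> orthant m" "b \<in> orthant m" "x \<in> coord_face m I" "x \<in> open_segment a b"
  then obtain u where u: "0 < u" "u < 1" "x = (1 - u) *\<^sub>R a + u *\<^sub>R b"
    by (auto simp: in_segment)
  have "a i = 0 \<and> b i = 0" if "i \<notin> I" for i
  proof -
    have "(1 - u) * a i + u * b i = 0"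
      using ab(3) that u(3) by (auto simp: coord_face_def scaleR_fun_def)
    moreover have "0 \<le> a i" "0 \<le> b i" using ab(1,2) by (auto simp: orthant_iff)
    ultimately show ?thesis
      using u(1,2) by (smt (verit) mult_nonneg_nonneg mult_pos_pos)
  qed
  then show "a \<in> coord_face m I" "b \<in> coord_face m I" using ab by (auto simp: coord_face_def)
qed

text \<open>\<open>I\<close> collects the coordinates that are positive somewhere on the face. By
  convexity one point \<open>z\<close> of the face is positive on all of \<open>I\<close>, and any
  other point of the coordinate face is an end of a segment in the orthant with \<open>z\<close> in
  its interior.\<close>

lemma face_of_orthantE:
  assumes Y: "Y face_of orthant m" "Y \<noteq> {}"
  obtains I where "I \<subseteq> {..<m}" "Y = coord_face m I"
proof
  define I where "I = {i. \<exists>y\<in>Y. 0 < y i}"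
  have sub: "Y \<subseteq> orthant m" and cv: "convex Y" using Y by (auto simp: face_of_def)
  show I: "I \<subseteq> {..<m}"
  proof
    fix i assume "i \<in> I"
    then obtain y where "y \<in> orthant m" "0 < y i" using sub by (auto simp: I_def)
    then show "i \<in> {..<m}" by (cases "i < m") (auto simp: orthant_iff)
  qed
  have "finite I" using I finite_subset by blast
  have "\<exists>z\<in>Y. \<forall>i\<in>J. 0 < z i" if "finite J" "J \<subseteq> I" for J
    using that
  proof (induction J rule: finite_induct)
    case empty
    then show ?case using Y by auto
  next
    case (insert k J)
    then obtain z where z: "z \<in> Y" "\<forall>i\<in>J. 0 < z i" by auto
    obtain y where y: "y \<in> Y" "0 < y k" using insert.prems by (auto simp: I_def)
    have nonneg: "0 \<le> z i" "0 \<le> y i" for i using z y sub by (auto simp: orthant_iff)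
    \<comment> \<open>All coordinates being nonnegative, the midpoint is positive wherever one of
      the two points is.\<close>
    have "(1/2) *\<^sub>R z + (1/2) *\<^sub>R y \<in> Y" using cv z y by (auto simp: convex_def)
    moreover have "\<forall>i\<in>insert k J. 0 < ((1/2) *\<^sub>R z + (1/2) *\<^sub>R y) i"
    proof
      fix i assume "i \<in> insert k J"
      then have "0 < z i \<or> 0 < y i" using z y by auto
      then show "0 < ((1/2) *\<^sub>R z + (1/2) *\<^sub>R y) i"
        using nonneg[of i] by (auto simp: scaleR_fun_def)
    qed
    ultimately show ?case by blast
  qed
  from this[OF \<open>finite I\<close> order_refl] obtain z where
    z: "z \<in> Y" "\<forall>i\<in>I. 0 < z i" by (elim bexE)
  have Y0: "y i = 0" if "y \<in> Y" "i \<notin> I" for y i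
  proof -
    have "0 \<le> y i" using that(1) sub by (auto simp: orthant_iff)
    moreover have "\<not> 0 < y i" using that by (simp add: I_def)
    ultimately show ?thesis by simp
  qed
  note z0 = Y0[OF z(1)]
  show "Y = coord_face m I"
  proof (intro equalityI subsetI)
    fix y assume "y \<in> Y"
    then show "y \<in> coord_face m I"
      using sub Y0 by (auto simp: coord_face_def)
  next
    fix x assume x: "x \<in> coord_face m I"
    have x_nonneg: "0 \<le> x i" for i using x by (auto simp: coord_face_def orthant_iff)
    \<comment> \<open>Chosen so that \<open>\<epsilon> * x i \<le> z i\<close> on \<open>I\<close>.
      The summand 1 keeps the denominator positive, and the inserted 1 covers empty
      \<open>I\<close>.\<close>
    define \<epsilon> where "\<epsilon> = Min (insert 1 ((\<lambda>i. z i / (1 + x i)) ` I))"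
    have \<epsilon>: "0 < \<epsilon>"
      unfolding \<epsilon>_def using \<open>finite I\<close> z x_nonneg by (auto intro!: divide_pos_pos add_pos_nonneg)
    have \<epsilon>_le: "\<epsilon> * x i \<le> z i" if "i \<in> I" for i
    proof -
      have "\<epsilon> \<le> z i / (1 + x i)" unfolding \<epsilon>_def using \<open>finite I\<close> that by (intro Min_le) auto
      then have "\<epsilon> * (1 + x i) \<le> z i" using x_nonneg[of i] by (simp add: field_simps)
      then show ?thesis using \<epsilon> by (simp add: algebra_simps)
    qed
    \<comment> \<open>This is \<open>z + \<epsilon> (z - x)\<close>, the segment from
      \<open>x\<close> to \<open>z\<close> prolonged beyond \<open>z\<close>.\<close>
    define w where "w = (1 + \<epsilon>) *\<^sub>R z - \<epsilon> *\<^sub>R x"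
    have w: "w \<in> orthant m"
      unfolding orthant_iff
    proof (intro conjI allI impI)
      fix i
      show "0 \<le> w i"
      proof (cases "i \<in> I")
        case True
        have "0 \<le> \<epsilon> * z i" using \<epsilon> bspec[OF z(2) True] by simp
        then show ?thesis
          using \<epsilon>_le[OF True] by (simp add: w_def scaleR_fun_def algebra_simps)
      next
        case False
        then show ?thesis using z0 x by (simp add: w_def scaleR_fun_def coord_face_def)
      qed
      assume "m \<le> i"
      then have "i \<notin> I" using I by auto
      then show "w i = 0" using z0 x by (simp add: w_def scaleR_fun_def coord_face_def)
    qed
    show "x \<in> Y"
    proof (cases "x = z")
      case False
      have z_eq: "z = (1 - \<epsilon> / (1 + \<epsilon>)) *\<^sub>R w + (\<epsilon> / (1 + \<epsilon>)) *\<^sub>R x"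
      proof
        fix i
        have ne: "1 + \<epsilon> \<noteq> 0" using \<epsilon> by simp
        have "(1 + \<epsilon>) * z i = w i + \<epsilon> * x i" by (simp add: w_def scaleR_fun_def)
        then have "z i = (w i + \<epsilon> * x i) / (1 + \<epsilon>)"
          using nonzero_mult_div_cancel_left[OF ne, of "z i"] by simp
        moreover have "1 - \<epsilon> / (1 + \<epsilon>) = 1 / (1 + \<epsilon>)" using ne by (simp add: divide_simps)
        ultimately show "z i = ((1 - \<epsilon> / (1 + \<epsilon>)) *\<^sub>R w + (\<epsilon> / (1 + \<epsilon>)) *\<^sub>R x) i"
          by (simp add: scaleR_fun_def add_divide_distrib)
      qed
      have "w \<noteq> x"
      proof
        assume "w = x"
        then have "z = x" using z_eq by (simp add: scaleR_left_distrib[symmetric])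
        then show False using False by simp
      qed
      moreover have "0 < \<epsilon> / (1 + \<epsilon>)" "\<epsilon> / (1 + \<epsilon>) < 1" using \<epsilon> by simp_all
      ultimately have "z \<in> open_segment w x" using z_eq by (auto simp: in_segment)
      moreover have "x \<in> orthant m" using x by (simp add: coord_face_def)
      ultimately show ?thesis using face_ofD[OF Y(1)] w z(1) by blast
    qed (use z in simp)
  qed
qed

lemma closedin_coord_face: "closedin (Euclidean_space m) (coord_face m I)"
proof -
  have eq: "coord_face m I = {x. (\<forall>i. m \<le> i \<or> i \<notin> I \<longrightarrow> x i = 0) \<and> (\<forall>i. 0 \<le> x i)}"
    by (auto simp: coord_face_def orthant_iff)
  have "closed (coord_face m I)"
    unfolding eq
    by (intro closed_Collect_conj closed_Collect_all closed_Collect_imp open_Collect_const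
        closed_Collect_eq closed_Collect_le continuous_on_product_coordinates continuous_on_const)
  moreover have "coord_face m I \<subseteq> topspace (Euclidean_space m)"
    by (auto simp: coord_face_def orthant_def)
  ultimately show ?thesis by (simp add: closedin_Euclidean_space_iff)
qed

lemma closedin_face_of_orthant: "Y face_of orthant m \<Longrightarrow> closedin (Euclidean_space m) Y"
  using closedin_coord_face by (cases "Y = {}") (auto elim: face_of_orthantE)

text \<open>The only vertex is 0, and the cone is spanned by the unit vectors with index in
  \<open>I\<close>.\<close>

lemma lattice_polyhedron_coord_face:
  assumes I: "I \<subseteq> {..<m}"
  shows "lattice_polyhedron m (coord_face m I)"
proof -
  define e :: "nat \<Rightarrow> nat \<Rightarrow> real" where "e i = (\<lambda>k. if k = i then 1 else 0)" for i
  let ?R = "e ` I"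
  have fin: "finite I" using I finite_subset by blast
  have "convex_cone hull ?R \<subseteq> coord_face m I"
  proof (rule hull_minimal)
    show "?R \<subseteq> coord_face m I" using I by (auto simp: coord_face_iff e_def)
    show "convex_cone (coord_face m I)"
      unfolding convex_cone_def conic_def convex_def
      using I by (auto simp: coord_face_iff scaleR_fun_def intro!: exI[of _ "\<lambda>_. 0"])
  qed
  moreover have "coord_face m I \<subseteq> convex_cone hull ?R"
  proof
    fix x assume x: "x \<in> coord_face m I"
    have "(\<lambda>k. if k \<in> J then x k else 0) \<in> convex_cone hull ?R" if "finite J" "J \<subseteq> I" for J
      using that
    proof (induction J rule: finite_induct)
      case empty
      then show ?case using convex_cone_hull_contains_0[of ?R] by (simp add: zero_fun_def)
    next
      case (insert i J)
      have "x i *\<^sub>R e i \<in> convex_cone hull ?R"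
        using x I insert.prems by (intro convex_cone_hull_mul hull_inc) (auto simp: coord_face_iff)
      moreover have "(\<lambda>k. if k \<in> J then x k else 0) \<in> convex_cone hull ?R"
        using insert by simp
      moreover have "(\<lambda>k. if k \<in> insert i J then x k else 0) =
          x i *\<^sub>R e i + (\<lambda>k. if k \<in> J then x k else 0)"
        using insert.hyps by (auto simp: fun_eq_iff scaleR_fun_def e_def)
      ultimately show ?case using convex_cone_hull_add by simp
    qed
    from this[OF fin order_refl] show "x \<in> convex_cone hull ?R"
    proof (rule back_subst[of "\<lambda>y. y \<in> convex_cone hull ?R"])
      show "(\<lambda>k. if k \<in> I then x k else 0) = x"
        using x I by (auto simp: coord_face_iff fun_eq_iff)
    qed
  qed
  ultimately have "coord_face m I =
      {a + r |a r. a \<in> convex hull {0} \<and> r \<in> convex_cone hull ?R}" by auto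
  moreover have "?R \<subseteq> int_lattice m" "{0} \<subseteq> int_lattice m"
    using I by (auto simp: int_lattice_def topspace_Euclidean_space e_def)
  ultimately show ?thesis
    unfolding lattice_polyhedron_def using fin by (intro exI[of _ "{0}"] exI[of _ ?R]) auto
qed

lemma lattice_polyhedron_face_of_orthant:
  assumes "Y face_of orthant m"
  shows "lattice_polyhedron m Y"
proof (cases "Y = {}")
  case True
  then show ?thesis
    unfolding lattice_polyhedron_def by (intro exI[of _ "{}"]) auto
next
  case False
  then show ?thesis using lattice_polyhedron_coord_face assms by (auto elim: face_of_orthantE)
qed

lemma affine_hull_coord_face:
  assumes I: "I \<subseteq> {..<m}"
  shows "affine hull coord_face m I = {x. \<forall>i. i \<notin> I \<longrightarrow> x i = 0}"
proof
  show "affine hull coord_face m I \<subseteq> {x. \<forall>i. i \<notin> I \<longrightarrow> x i = 0}"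
    by (rule hull_minimal) (auto simp: coord_face_def affine_def scaleR_fun_def)
  show "{x. \<forall>i. i \<notin> I \<longrightarrow> x i = 0} \<subseteq> affine hull coord_face m I"
  proof
    fix x :: "nat \<Rightarrow> real" assume x: "x \<in> {x. \<forall>i. i \<notin> I \<longrightarrow> x i = 0}"
    \<comment> \<open>The positive and negative parts of \<open>x\<close> lie in the coordinate
      face; the point 0 brings their coefficients 1 and -1 to the total 1.\<close>
    have "(\<lambda>i. max (x i) 0) \<in> coord_face m I" "(\<lambda>i. max (- x i) 0) \<in> coord_face m I"
      "0 \<in> coord_face m I"
      using x I by (auto simp: coord_face_iff)
    then have "1 *\<^sub>R (\<lambda>i. max (x i) 0) + (- 1) *\<^sub>R (\<lambda>i. max (- x i) 0) + 1 *\<^sub>R 0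
        \<in> affine hull coord_face m I"
      by (intro mem_affine_3 affine_affine_hull hull_inc) auto
    moreover have "1 *\<^sub>R (\<lambda>i. max (x i) 0) + (- 1) *\<^sub>R (\<lambda>i. max (- x i) 0) + 1 *\<^sub>R 0 = x"
      by (auto simp: fun_eq_iff scaleR_fun_def max_def)
    ultimately show "x \<in> affine hull coord_face m I" by simp
  qed
qed

section \<open>Lattice equivalence\<close>

lemma affine_iso_inv_into:
  assumes f: "affine_iso f V W" and V: "affine V"
  shows "affine_iso (inv_into V f) W V"
  unfolding affine_iso_def
proof (intro conjI ballI allI)
  let ?g = "inv_into V f"
  have bij: "bij_betw f V W" using f by (simp add: affine_iso_def)
  then show "bij_betw ?g W V" by (rule bij_betw_inv_into)
  fix x y t assume xy: "x \<in> W" "y \<in> W"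
  have g: "?g x \<in> V" "?g y \<in> V" "f (?g x) = x" "f (?g y) = y"
    using xy bij by (auto simp: bij_betw_def inv_into_into f_inv_into_f)
  have "f ((1 - t) *\<^sub>R ?g x + t *\<^sub>R ?g y) = (1 - t) *\<^sub>R x + t *\<^sub>R y"
    using f g by (simp add: affine_iso_def)
  moreover have "(1 - t) *\<^sub>R ?g x + t *\<^sub>R ?g y \<in> V"
    using V g by (simp add: affine_def)
  ultimately show "?g ((1 - t) *\<^sub>R x + t *\<^sub>R y) = (1 - t) *\<^sub>R ?g x + t *\<^sub>R ?g y"
    using bij by (metis bij_betw_inv_into_left)
qed

text \<open>With transitivity, this reduces statements on arbitrary charts of a class to the single
  chart \<open>H_chart\<close>.\<close>

lemma lattice_equivalent_sym:
  assumes "lattice_equivalent c c'"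
  shows "lattice_equivalent c' c"
proof -
  let ?V = "affine hull chart_dom c" and ?W = "affine hull chart_dom c'"
  obtain f where f: "affine_iso f ?V ?W" "f ` chart_dom c = chart_dom c'"
      "\<forall>x\<in>chart_dom c. chart_map c x = chart_map c' (f x)"
      "f ` (?V \<inter> int_lattice (chart_dim c)) = ?W \<inter> int_lattice (chart_dim c')"
    using assms by (auto simp: lattice_equivalent_def)
  let ?g = "inv_into ?V f"
  have inj: "inj_on f ?V" using f by (simp add: affine_iso_def bij_betw_def)
  have sub: "chart_dom c \<subseteq> ?V" by (rule hull_subset)
  have "affine_iso ?g ?W ?V" by (rule affine_iso_inv_into[OF f(1) affine_affine_hull])
  moreover have "?g ` chart_dom c' = chart_dom c"
    unfolding f(2)[symmetric] by (rule inv_into_image_cancel[OF inj sub])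
  moreover have "\<forall>x\<in>chart_dom c'. chart_map c' x = chart_map c (?g x)"
    unfolding f(2)[symmetric] using f(3) inv_into_f_f[OF inj] sub by auto
  moreover have "?g ` (?W \<inter> int_lattice (chart_dim c')) = ?V \<inter> int_lattice (chart_dim c)"
    unfolding f(4)[symmetric] by (rule inv_into_image_cancel[OF inj]) simp
  ultimately show ?thesis unfolding lattice_equivalent_def by blast
qed

lemma lattice_equivalent_trans:
  assumes "lattice_equivalent c c'" "lattice_equivalent c' c''"
  shows "lattice_equivalent c c''"
proof -
  let ?U = "affine hull chart_dom c" and ?V = "affine hull chart_dom c'"
    and ?W = "affine hull chart_dom c''"
  obtain f where f: "affine_iso f ?U ?V" "f ` chart_dom c = chart_dom c'"
      "\<forall>x\<in>chart_dom c. chart_map c x = chart_map c' (f x)"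
      "f ` (?U \<inter> int_lattice (chart_dim c)) = ?V \<inter> int_lattice (chart_dim c')"
    using assms(1) by (auto simp: lattice_equivalent_def)
  obtain g where g: "affine_iso g ?V ?W" "g ` chart_dom c' = chart_dom c''"
      "\<forall>x\<in>chart_dom c'. chart_map c' x = chart_map c'' (g x)"
      "g ` (?V \<inter> int_lattice (chart_dim c')) = ?W \<inter> int_lattice (chart_dim c'')"
    using assms(2) by (auto simp: lattice_equivalent_def)
  have fV: "f x \<in> ?V" if "x \<in> ?U" for x
    using f(1) that by (auto simp: affine_iso_def bij_betw_def)
  have "affine_iso (g \<circ> f) ?U ?W"
    unfolding affine_iso_def
  proof (intro conjI ballI allI)
    show "bij_betw (g \<circ> f) ?U ?W"
      using f(1) g(1) by (auto simp: affine_iso_def intro: bij_betw_trans)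
    show "(g \<circ> f) ((1 - t) *\<^sub>R x + t *\<^sub>R y) = (1 - t) *\<^sub>R (g \<circ> f) x + t *\<^sub>R (g \<circ> f) y"
      if "x \<in> ?U" "y \<in> ?U" for x y t
      using f(1) g(1) that fV by (simp add: affine_iso_def)
  qed
  moreover have "(g \<circ> f) ` chart_dom c = chart_dom c''"
    by (simp only: image_comp[symmetric] f(2) g(2))
  moreover have "\<forall>x\<in>chart_dom c. chart_map c x = chart_map c'' ((g \<circ> f) x)"
    using f(2,3) g(3) by auto
  moreover have "(g \<circ> f) ` (?U \<inter> int_lattice (chart_dim c)) = ?W \<inter> int_lattice (chart_dim c'')"
    by (simp only: image_comp[symmetric] f(4) g(4))
  ultimately show ?thesis unfolding lattice_equivalent_def by blast
qed

text \<open>The condition on faces concerns every chart of a class; pulling a face back along the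
  affine isomorphism reduces it to one representative.\<close>

lemma lattice_equivalent_face:
  assumes eq: "lattice_equivalent c c'" and cv: "convex (chart_dom c)" and Y: "Y face_of chart_dom c'"
  obtains Z where "Z face_of chart_dom c" "chart_map c ` Z = chart_map c' ` Y"
proof -
  let ?V = "affine hull chart_dom c"
  obtain f where f: "affine_iso f ?V (affine hull chart_dom c')" "f ` chart_dom c = chart_dom c'"
      "\<forall>x\<in>chart_dom c. chart_map c x = chart_map c' (f x)"
    using eq by (auto simp: lattice_equivalent_def)
  have inj: "inj_on f ?V" using f by (simp add: affine_iso_def bij_betw_def)
  have sub: "chart_dom c \<subseteq> ?V" by (rule hull_subset)
  have comb: "f ((1 - t) *\<^sub>R x + t *\<^sub>R y) = (1 - t) *\<^sub>R f x + t *\<^sub>R f y"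
    if "x \<in> chart_dom c" "y \<in> chart_dom c" for x y t
    using f(1) that sub by (auto simp: affine_iso_def)
  have cvY: "convex Y" and Y_sub: "Y \<subseteq> chart_dom c'" using Y by (auto simp: face_of_def)
  define Z where "Z = {x \<in> chart_dom c. f x \<in> Y}"
  have "Z face_of chart_dom c"
    unfolding face_of_def
  proof (intro conjI ballI impI)
    show "Z \<subseteq> chart_dom c" by (auto simp: Z_def)
    show "convex Z"
      unfolding convex_alt
    proof (intro ballI allI impI)
      fix x y u assume xy: "x \<in> Z" "y \<in> Z" and u: "0 \<le> u \<and> u \<le> (1::real)"
      have Z: "x \<in> chart_dom c" "y \<in> chart_dom c" "f x \<in> Y" "f y \<in> Y"
        using xy by (simp_all add: Z_def)
      have "(1 - u) *\<^sub>R x + u *\<^sub>R y \<in> chart_dom c"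
        using convexD_alt[OF cv Z(1,2)] u by blast
      moreover have "f ((1 - u) *\<^sub>R x + u *\<^sub>R y) \<in> Y"
        unfolding comb[OF Z(1,2)] using convexD_alt[OF cvY Z(3,4)] u by blast
      ultimately show "(1 - u) *\<^sub>R x + u *\<^sub>R y \<in> Z" by (simp add: Z_def)
    qed
    fix a b x assume ab: "a \<in> chart_dom c" "b \<in> chart_dom c" and x: "x \<in> Z" "x \<in> open_segment a b"
    then obtain u where u: "a \<noteq> b" "0 < u" "u < 1" "x = (1 - u) *\<^sub>R a + u *\<^sub>R b"
      by (auto simp: in_segment)
    \<comment> \<open>An open segment has distinct ends, so transferring it rests on injectivity of
      \<open>f\<close>.\<close>
    have "f a \<noteq> f b" using inj_onD[OF inj, of a b] ab u(1) sub by auto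
    moreover have "f x = (1 - u) *\<^sub>R f a + u *\<^sub>R f b" unfolding u(4) by (rule comb[OF ab])
    ultimately have seg: "f x \<in> open_segment (f a) (f b)"
      unfolding in_segment using u(2,3) by blast
    have "f a \<in> chart_dom c'" "f b \<in> chart_dom c'"
      unfolding f(2)[symmetric] using ab by simp_all
    moreover have "f x \<in> Y" using x(1) by (simp add: Z_def)
    ultimately have "f a \<in> Y \<and> f b \<in> Y" by (rule face_ofD[OF Y seg])
    then show "a \<in> Z" "b \<in> Z" using ab by (auto simp: Z_def)
  qed
  moreover have "chart_map c ` Z = chart_map c' ` Y"
  proof -
    have "f ` Z = f ` chart_dom c \<inter> Y" by (auto simp: Z_def)
    then have "f ` Z = Y" unfolding f(2) using Y_sub by blast
    moreover have "chart_map c ` Z = chart_map c' ` f ` Z"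
      unfolding image_image using f(3) by (intro image_cong) (simp_all add: Z_def)
    ultimately show ?thesis by simp
  qed
  ultimately show thesis by (rule that)
qed

section \<open>The cells of \<open>\<H>\<close>\<close>

lemma topspace_quotient_topology: "topspace (quotient_topology X r) = topspace X // r"
proof -
  have "{x \<in> topspace X. r `` {x} \<in> topspace X // r} = topspace X" by (auto intro: quotientI)
  then have "openin (quotient_topology X r) (topspace X // r)"
    by (simp add: openin_quotient_topology)
  then have "topspace X // r \<subseteq> topspace (quotient_topology X r)" by (rule openin_subset)
  moreover have "topspace (quotient_topology X r) \<subseteq> topspace X // r"
    using openin_topspace[of "quotient_topology X r"]
    unfolding openin_quotient_topology[of X r "topspace (quotient_topology X r)"] by (rule conjunct1)
  ultimately show ?thesis by (intro equalityI)
qed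

lemma closedin_quotient_topology:
  "closedin (quotient_topology X r) K \<longleftrightarrow>
    K \<subseteq> topspace X // r \<and> closedin X {x \<in> topspace X. r `` {x} \<in> K}"
proof -
  have "{x \<in> topspace X. r `` {x} \<in> topspace X // r - K} =
      topspace X - {x \<in> topspace X. r `` {x} \<in> K}" by (auto intro: quotientI)
  moreover have "{x \<in> topspace X. r `` {x} \<in> K} \<subseteq> topspace X" "topspace X // r - K \<subseteq> topspace X // r"
    by blast+
  ultimately show ?thesis
    by (simp add: closedin_def openin_quotient_topology topspace_quotient_topology)
qed

lemma topspace_H_space: "topspace (H_space d n \<sigma>) = H_proj d n \<sigma> ` topspace (D_space d n \<sigma>)"
  unfolding H_space_def topspace_quotient_topology by (auto simp: quotient_def H_proj_def)

section \<open>The quotient map on a single orthant\<close>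

lemma continuous_map_H_proj:
  assumes "g \<in> acceptable_data d n \<sigma>"
  shows "continuous_map (subtopology (Euclidean_space (n - 3)) (orthant (n - 3)))
    (H_space d n \<sigma>) (\<lambda>p. H_proj d n \<sigma> (g, p))"
  unfolding continuous_map_def
proof (intro conjI allI impI)
  have orth: "topspace (subtopology (Euclidean_space (n - 3)) (orthant (n - 3))) = orthant (n - 3)"
    by (auto simp: orthant_def)
  show "(\<lambda>p. H_proj d n \<sigma> (g, p)) \<in>
      topspace (subtopology (Euclidean_space (n - 3)) (orthant (n - 3))) \<rightarrow> topspace (H_space d n \<sigma>)"
    unfolding orth topspace_H_space topspace_D_space using assms by auto
  fix U assume "openin (H_space d n \<sigma>) U"
  then have "openin (D_space d n \<sigma>) {x \<in> topspace (D_space d n \<sigma>). H_proj d n \<sigma> x \<in> U}"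
    by (simp add: H_space_def openin_quotient_topology H_proj_def)
  then have "openin (subtopology (Euclidean_space (n - 3)) (orthant (n - 3)))
      {p. (g, p) \<in> {x \<in> topspace (D_space d n \<sigma>). H_proj d n \<sigma> x \<in> U}}"
    using assms by (simp add: openin_sum_topology D_space_def)
  moreover have "{p. (g, p) \<in> {x \<in> topspace (D_space d n \<sigma>). H_proj d n \<sigma> x \<in> U}} =
      {p \<in> orthant (n - 3). H_proj d n \<sigma> (g, p) \<in> U}"
    using assms by (auto simp: topspace_D_space)
  ultimately show "openin (subtopology (Euclidean_space (n - 3)) (orthant (n - 3)))
      {p \<in> topspace (subtopology (Euclidean_space (n - 3)) (orthant (n - 3))). H_proj d n \<sigma> (g, p) \<in> U}"
    unfolding orth by simp
qed

text \<open>In each orthant, the points identified with points of \<open>K\<close> form the part of a coordinate face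
  that \<open>transport\<close> maps into \<open>K\<close>.\<close>

lemma closedin_H_proj_image:
  assumes n: "0 < n" and g: "g \<in> acceptable_data d n \<sigma>"
    and K: "closedin (Euclidean_space (n - 3)) K" "K \<subseteq> orthant (n - 3)"
  shows "closedin (H_space d n \<sigma>) ((\<lambda>p. H_proj d n \<sigma> (g, p)) ` K)"
proof -
  let ?m = "n - 3" and ?P = "(\<lambda>p. H_proj d n \<sigma> (g, p)) ` K" and ?b = "edge_label n"
  have injb: "inj_on (?b g') {..<?m}" if "g' \<in> acceptable_data d n \<sigma>" for g'
    by (rule inj_on_edge_label[OF that n])
  have slice: "{q. (g', q) \<in> {x \<in> topspace (D_space d n \<sigma>). H_proj d n \<sigma> x \<in> ?P}} =
      coord_face ?m (matched ?m (?b g') (?b g)) \<inter> transport ?m (?b g') (?b g) -` K"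
    if g': "g' \<in> acceptable_data d n \<sigma>" for g'
  proof -
    have "H_proj d n \<sigma> (g', q) \<in> ?P \<longleftrightarrow>
        (\<forall>i. i \<notin> matched ?m (?b g') (?b g) \<longrightarrow> q i = 0) \<and> transport ?m (?b g') (?b g) q \<in> K"
      if q: "q \<in> orthant ?m" for q
    proof -
      have "H_proj d n \<sigma> (g', q) = H_proj d n \<sigma> (g, p) \<longleftrightarrow>
          (\<forall>i. i \<notin> matched ?m (?b g') (?b g) \<longrightarrow> q i = 0) \<and> p = transport ?m (?b g') (?b g) q"
        if p: "p \<in> K" for p
      proof -
        have "p \<in> orthant ?m" using p K(2) by blast
        then show ?thesis
          using H_proj_eq_iff[OF n g' q g] weights_eq_iff[OF injb[OF g'] injb[OF g] q] by simp
      qed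
      then show ?thesis by auto
    qed
    then show ?thesis using g' by (auto simp: topspace_D_space coord_face_def)
  qed
  have "closedin (D_space d n \<sigma>) {x \<in> topspace (D_space d n \<sigma>). H_proj d n \<sigma> x \<in> ?P}"
    unfolding D_space_def closedin_sum_topology
  proof (fold D_space_def, intro conjI ballI)
    show "{x \<in> topspace (D_space d n \<sigma>). H_proj d n \<sigma> x \<in> ?P} \<subseteq>
        Sigma (acceptable_data d n \<sigma>) (topspace \<circ> (\<lambda>_. subtopology (Euclidean_space ?m) (orthant ?m)))"
      by (auto simp: D_space_def)
    fix g' assume g': "g' \<in> acceptable_data d n \<sigma>"
    have "closed (coord_face ?m (matched ?m (?b g') (?b g)))" "closed K"
      using closedin_coord_face K(1) by (auto intro: closedin_Euclidean_imp_closed)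
    then have "closed (coord_face ?m (matched ?m (?b g') (?b g)) \<inter> transport ?m (?b g') (?b g) -` K)"
      by (intro closed_Int closed_vimage continuous_transport)
    moreover have sub: "coord_face ?m (matched ?m (?b g') (?b g)) \<subseteq> orthant ?m"
      by (auto simp: coord_face_def)
    moreover have "orthant ?m \<subseteq> topspace (Euclidean_space ?m)" by (auto simp: orthant_def)
    ultimately have "closedin (Euclidean_space ?m)
        (coord_face ?m (matched ?m (?b g') (?b g)) \<inter> transport ?m (?b g') (?b g) -` K)"
      unfolding closedin_Euclidean_space_iff by blast
    then show "closedin (subtopology (Euclidean_space ?m) (orthant ?m))
        {q. (g', q) \<in> {x \<in> topspace (D_space d n \<sigma>). H_proj d n \<sigma> x \<in> ?P}}"
      unfolding slice[OF g'] using sub by (intro closedin_subset_topspace) blast+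
  qed
  moreover have "?P \<subseteq> topspace (D_space d n \<sigma>) // identified d n \<sigma>"
    using g K(2) by (auto simp: topspace_D_space H_proj_def intro!: quotientI)
  ultimately show ?thesis
    unfolding H_space_def closedin_quotient_topology H_proj_def by blast
qed

text \<open>\<open>transport\<close> from a labelling to itself fixes every point of the orthant, as
  \<open>weights_eq_iff\<close> shows for a point and itself; for identified \<open>p\<close> and
  \<open>q\<close> it also sends \<open>p\<close> to \<open>q\<close>.\<close>

lemma inj_on_H_proj:
  assumes n: "0 < n" and g: "g \<in> acceptable_data d n \<sigma>"
  shows "inj_on (\<lambda>p. H_proj d n \<sigma> (g, p)) (orthant (n - 3))"
proof (rule inj_onI)
  let ?m = "n - 3" and ?b = "edge_label n g"
  fix p q assume pq: "p \<in> orthant ?m" "q \<in> orthant ?m" "H_proj d n \<sigma> (g, p) = H_proj d n \<sigma> (g, q)"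
  note inj = inj_on_edge_label[OF g n]
  have W: "weights ?m ?b p = weights ?m ?b q"
    using pq by (simp add: H_proj_eq_iff[OF n g pq(1) g pq(2)])
  have "q = transport ?m ?b ?b p" using W weights_eq_iff[OF inj inj pq(1,2)] by simp
  moreover have "p = transport ?m ?b ?b p" using weights_eq_iff[OF inj inj pq(1,1)] by simp
  ultimately show "p = q" by simp
qed

lemma H_cell_eq: "H_cell d n \<sigma> (g, Y) = (\<lambda>p. H_proj d n \<sigma> (g, p)) ` Y"
  by (simp add: H_cell_def)

text \<open>On \<open>Y\<close> the quotient map is continuous, closed and injective, hence a
  homeomorphism onto its image. As \<open>Y\<close> is closed, its closed subsets are closed in the
  Euclidean space, so \<open>closedin_H_proj_image\<close> applies to them.\<close>

lemma chart_for_H_chart: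
  assumes n: "0 < n" and g: "g \<in> acceptable_data d n \<sigma>" and Y: "Y face_of orthant (n - 3)"
  shows "chart_for (H_space d n \<sigma>) (H_cell d n \<sigma> (g, Y)) (H_chart d n \<sigma> (g, Y))"
proof -
  let ?m = "n - 3" and ?h = "\<lambda>p. H_proj d n \<sigma> (g, p)"
  let ?E = "subtopology (Euclidean_space ?m) Y" and ?H = "subtopology (H_space d n \<sigma>) (?h ` Y)"
  have sub: "Y \<subseteq> orthant ?m" using Y by (simp add: face_of_imp_subset)
  have closed_Y: "closedin (Euclidean_space ?m) Y" by (rule closedin_face_of_orthant[OF Y])
  have topE: "topspace ?E = Y" using closedin_subset[OF closed_Y] by auto
  have closed_P: "closedin (H_space d n \<sigma>) (?h ` Y)"
    by (rule closedin_H_proj_image[OF n g closed_Y sub])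
  have topH: "topspace ?H = ?h ` Y" using closedin_subset[OF closed_P] by auto
  have "continuous_map ?E ?H ?h"
  proof -
    have "?E = subtopology (subtopology (Euclidean_space ?m) (orthant ?m)) Y"
      using sub by (simp add: subtopology_subtopology Int_absorb1)
    then have "continuous_map ?E (H_space d n \<sigma>) ?h"
      using continuous_map_from_subtopology[OF continuous_map_H_proj[OF g]] by simp
    then show ?thesis using topE by (auto simp: continuous_map_in_subtopology)
  qed
  moreover have "closed_map ?E ?H ?h"
    unfolding closed_map_def
  proof (intro allI impI)
    fix K assume K: "closedin ?E K"
    then have "closedin (Euclidean_space ?m) K" "K \<subseteq> Y"
      using closedin_closed_subtopology[OF closed_Y] by auto
    then show "closedin ?H (?h ` K)"
      using sub closedin_H_proj_image[OF n g, of K] by (intro closedin_subset_topspace) auto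
  qed
  moreover have "inj_on ?h (topspace ?E)"
    unfolding topE by (rule inj_on_subset[OF inj_on_H_proj[OF n g] sub])
  ultimately have "homeomorphic_map ?E ?H ?h"
    using topE topH by (intro bijective_closed_imp_homeomorphic_map) simp_all
  then show ?thesis
    using closed_P lattice_polyhedron_face_of_orthant[OF Y]
    by (simp add: chart_for_def H_chart_def H_cell_def)
qed

text \<open>The coordinates that may be positive at a common point of two cells: in contrast to
  \<open>matched\<close>, the partner has to belong to the second face.\<close>

definition match_face :: "(nat \<Rightarrow> 'c) \<Rightarrow> (nat \<Rightarrow> 'c) \<Rightarrow> nat set \<Rightarrow> nat set \<Rightarrow> nat set"
  where "match_face b b' I I' = {i \<in> I. b i \<in> b' ` I'}"

text \<open>A common point is given by \<open>p\<close> in the first orthant and by its transport in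
  the second. A coordinate of \<open>p\<close> equals that of its partner, so it vanishes when the
  partner is missing or lies outside \<open>I'\<close>.\<close>

lemma H_cell_Int_coord_face:
  assumes n: "0 < n" and g: "g \<in> acceptable_data d n \<sigma>" and g': "g' \<in> acceptable_data d n \<sigma>"
    and I: "I \<subseteq> {..<n - 3}" "I' \<subseteq> {..<n - 3}"
  shows "H_cell d n \<sigma> (g, coord_face (n - 3) I) \<inter> H_cell d n \<sigma> (g', coord_face (n - 3) I') =
    H_cell d n \<sigma> (g, coord_face (n - 3) (match_face (edge_label n g) (edge_label n g') I I'))"
    (is "?A \<inter> ?B = ?C")
proof -
  let ?m = "n - 3" and ?b = "edge_label n g" and ?b' = "edge_label n g'"
  let ?J = "match_face ?b ?b' I I'"
  have J: "?J \<subseteq> {..<?m}" using I by (auto simp: match_face_def)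
  note inj = inj_on_edge_label[OF g n] inj_on_edge_label[OF g' n]
  have orth: "p \<in> orthant ?m" if "p \<in> coord_face ?m L" for p L
    using that by (simp add: coord_face_def)
  have eq_iff: "H_proj d n \<sigma> (g, p) = H_proj d n \<sigma> (g', q) \<longleftrightarrow>
      (\<forall>i. i \<notin> matched ?m ?b ?b' \<longrightarrow> p i = 0) \<and> q = transport ?m ?b ?b' p"
    if "p \<in> orthant ?m" "q \<in> orthant ?m" for p q
    using H_proj_eq_iff[OF n g that(1) g' that(2)] weights_eq_iff[OF inj that] by simp
  show ?thesis
  proof (intro equalityI subsetI)
    fix x assume "x \<in> ?A \<inter> ?B"
    then obtain p q where p: "p \<in> coord_face ?m I" "x = H_proj d n \<sigma> (g, p)"
        and q: "q \<in> coord_face ?m I'" "x = H_proj d n \<sigma> (g', q)"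
      by (auto simp: H_cell_eq)
    have "H_proj d n \<sigma> (g, p) = H_proj d n \<sigma> (g', q)" using p(2) q(2) by simp
    then have "(\<forall>i. i \<notin> matched ?m ?b ?b' \<longrightarrow> p i = 0) \<and> q = transport ?m ?b ?b' p"
      by (rule iffD1[OF eq_iff[OF orth[OF p(1)] orth[OF q(1)]]])
    then have unm: "\<forall>i. i \<notin> matched ?m ?b ?b' \<longrightarrow> p i = 0" and q_eq: "q = transport ?m ?b ?b' p"
      by simp_all
    have "p i = 0" if "i \<notin> ?J" for i
    proof (cases "i \<in> I \<and> i \<in> matched ?m ?b ?b'")
      case True
      from conjunct2[OF True] obtain j where j: "j < ?m" "i < ?m" "?b' j = ?b i" by (rule matchedE)
      have "j \<notin> I'"
      proof
        assume "j \<in> I'"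
        then have "?b i \<in> ?b' ` I'" using j(3) by (metis imageI)
        then show False using that True by (simp add: match_face_def)
      qed
      then have "q j = 0" using q(1) by (simp add: coord_face_def)
      then show ?thesis
        using transport_match[of ?b ?m i j ?b' p, OF inj(1) j(2,1) j(3)[symmetric]] q_eq by simp
    next
      case False
      then show ?thesis using unm p(1) by (auto simp: coord_face_def)
    qed
    then have "p \<in> coord_face ?m ?J" using p(1) by (simp add: coord_face_def)
    then show "x \<in> ?C" using p(2) by (auto simp: H_cell_eq)
  next
    fix x assume "x \<in> ?C"
    then obtain p where p: "p \<in> coord_face ?m ?J" "x = H_proj d n \<sigma> (g, p)"
      by (auto simp: H_cell_eq)
    let ?q = "transport ?m ?b ?b' p"
    have po: "p \<in> orthant ?m" by (rule orth[OF p(1)])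
    then have qo: "?q \<in> orthant ?m" by (rule transport_orthant[OF inj(1)])
    have "p \<in> coord_face ?m I" using p(1) by (auto simp: coord_face_def match_face_def)
    then have "x \<in> ?A" using p(2) by (auto simp: H_cell_eq)
    have "?J \<subseteq> matched ?m ?b ?b'" using I by (auto simp: match_face_def matched_def)
    then have "\<forall>i. i \<notin> matched ?m ?b ?b' \<longrightarrow> p i = 0" using p(1) by (auto simp: coord_face_def)
    then have "x = H_proj d n \<sigma> (g', ?q)" unfolding p(2) eq_iff[OF po qo] by simp
    moreover have "?q j = 0" if "j \<notin> I'" for j
    proof (cases "j \<in> matched ?m ?b' ?b")
      case True
      then obtain i where i: "i < ?m" "j < ?m" "?b i = ?b' j" by (rule matchedE)
      have "i \<notin> ?J"
      proof
        assume "i \<in> ?J"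
        then obtain j' where j': "j' \<in> I'" "?b i = ?b' j'" by (auto simp: match_face_def)
        then have "j' = j" using i I(2) by (intro inj_onD[OF inj(2)]) auto
        then show False using that j' by simp
      qed
      then have "p i = 0" using p(1) by (simp add: coord_face_def)
      then show ?thesis using transport_match[of ?b ?m i j ?b' p, OF inj(1) i] by simp
    qed (simp add: transport_unmatched)
    then have "?q \<in> coord_face ?m I'" using qo by (simp add: coord_face_def)
    ultimately have "x \<in> ?B" by (auto simp: H_cell_eq)
    with \<open>x \<in> ?A\<close> show "x \<in> ?A \<inter> ?B" by (rule IntI)
  qed
qed

lemma coord_face_inj:
  assumes "I \<subseteq> {..<m}" "J \<subseteq> {..<m}" "coord_face m I = coord_face m J"
  shows "I = J"
proof -
  \<comment> \<open>Indicator vectors detect inclusion of index sets.\<close>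
  have "(\<lambda>i. if i \<in> K then 1 else 0) \<in> coord_face m L \<longleftrightarrow> K \<subseteq> L" if "L \<subseteq> {..<m}" for K L
    using that by (auto simp: coord_face_iff)
  then show ?thesis using assms by (metis subset_antisym order_refl)
qed

text \<open>Equal nonempty cells coincide with their intersection, so the labels on \<open>I\<close>
  and \<open>I'\<close> match completely. Then \<open>transport\<close> merely renames coordinates,
  and is an affine bijection of the hulls that preserves lattice points in both directions.\<close>

lemma lattice_equivalent_H_chart:
  assumes n: "0 < n" and g: "g \<in> acceptable_data d n \<sigma>" and g': "g' \<in> acceptable_data d n \<sigma>"
    and Y: "Y face_of orthant (n - 3)" and Y': "Y' face_of orthant (n - 3)"
    and eq: "H_cell d n \<sigma> (g, Y) = H_cell d n \<sigma> (g', Y')"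
  shows "lattice_equivalent (H_chart d n \<sigma> (g, Y)) (H_chart d n \<sigma> (g', Y'))"
proof (cases "Y = {}")
  case True
  then have "Y' = {}" using eq[symmetric] by (simp add: H_cell_eq)
  with True show ?thesis
    unfolding lattice_equivalent_def H_chart_def affine_iso_def by (intro exI[of _ id]) simp
next
  case False
  then have "Y' \<noteq> {}" using eq unfolding H_cell_eq by (metis image_is_empty)
  let ?m = "n - 3" and ?b = "edge_label n g" and ?b' = "edge_label n g'"
  obtain I where I: "I \<subseteq> {..<?m}" "Y = coord_face ?m I" using face_of_orthantE[OF Y False] .
  obtain I' where I': "I' \<subseteq> {..<?m}" "Y' = coord_face ?m I'"
    using face_of_orthantE[OF Y' \<open>Y' \<noteq> {}\<close>] .
  note inj = inj_on_edge_label[OF g n] inj_on_edge_label[OF g' n]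
  \<comment> \<open>The quotient map is injective on one orthant, so there a cell determines its
    index set.\<close>
  have cancel: "I = J" if "h \<in> acceptable_data d n \<sigma>" "I \<subseteq> {..<?m}" "J \<subseteq> {..<?m}"
      "H_cell d n \<sigma> (h, coord_face ?m I) = H_cell d n \<sigma> (h, coord_face ?m J)" for h I J
  proof (rule coord_face_inj[OF that(2,3)])
    have sub: "coord_face ?m L \<subseteq> orthant ?m" for L by (auto simp: coord_face_def)
    show "coord_face ?m I = coord_face ?m J"
      using that(4) unfolding H_cell_eq inj_on_image_eq_iff[OF inj_on_H_proj[OF n that(1)] sub sub] .
  qed
  have sub: "match_face ?b ?b' I I' \<subseteq> {..<?m}" "match_face ?b' ?b I' I \<subseteq> {..<?m}"
    using I(1) I'(1) by (auto simp: match_face_def)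
  have eq': "H_cell d n \<sigma> (g, coord_face ?m I) = H_cell d n \<sigma> (g', coord_face ?m I')"
    using eq by (simp only: I(2) I'(2))
  have I_eq: "I = match_face ?b ?b' I I'"
    using H_cell_Int_coord_face[OF n g g' I(1) I'(1), unfolded eq'[symmetric] Int_absorb]
    by (rule cancel[OF g I(1) sub(1)])
  have match: "\<exists>j\<in>I'. ?b i = ?b' j" if "i \<in> I" for i
    using subsetD[OF equalityD1[OF I_eq] that] by (auto simp: match_face_def)
  have I'_eq: "I' = match_face ?b' ?b I' I"
    using H_cell_Int_coord_face[OF n g' g I'(1) I(1), unfolded eq' Int_absorb]
    by (rule cancel[OF g' I'(1) sub(2)])
  have match': "\<exists>i\<in>I. ?b i = ?b' j" if "j \<in> I'" for j
    using subsetD[OF equalityD1[OF I'_eq] that] by (auto simp: match_face_def)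
  let ?f = "transport ?m ?b ?b'" and ?f' = "transport ?m ?b' ?b"
  let ?V = "\<lambda>I. {x :: nat \<Rightarrow> real. \<forall>i. i \<notin> I \<longrightarrow> x i = 0}"
  have hull: "affine hull Y = ?V I" "affine hull Y' = ?V I'"
    using I I' affine_hull_coord_face by simp_all
  have unm: "i \<in> matched ?m ?b ?b'" if "i \<in> I" for i
    using match[OF that] I(1) I'(1) that by (auto simp: matched_def)
  have unm': "j \<in> matched ?m ?b' ?b" if "j \<in> I'" for j
    using match'[OF that] I(1) I'(1) that by (force simp: matched_def)
  have fV: "?f x \<in> ?V I'" if x: "x \<in> ?V I" for x
  proof -
    have "?f x j = 0" if "j \<notin> I'" for j
    proof (cases "j \<in> matched ?m ?b' ?b")
      case True
      then obtain i where i: "i < ?m" "j < ?m" "?b i = ?b' j" by (rule matchedE)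
      have "i \<notin> I"
      proof
        assume "i \<in> I"
        then obtain j' where j': "j' \<in> I'" "?b i = ?b' j'" using match by blast
        then have "j' = j" using i I'(1) by (intro inj_onD[OF inj(2)]) auto
        then show False using that j' by simp
      qed
      then show ?thesis using transport_match[of ?b ?m i j ?b' x, OF inj(1) i] x by simp
    qed (simp add: transport_unmatched)
    then show ?thesis by simp
  qed
  have fV': "?f' y \<in> ?V I" if y: "y \<in> ?V I'" for y
  proof -
    have "?f' y i = 0" if "i \<notin> I" for i
    proof (cases "i \<in> matched ?m ?b ?b'")
      case True
      then obtain j where j: "j < ?m" "i < ?m" "?b' j = ?b i" by (rule matchedE)
      have "j \<notin> I'"
      proof
        assume "j \<in> I'"
        then obtain i' where i': "i' \<in> I" "?b i' = ?b' j" using match' by blast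
        then have "i' = i" using j I(1) by (intro inj_onD[OF inj(1)]) auto
        then show False using that i' by simp
      qed
      then show ?thesis using transport_match[of ?b' ?m j i ?b y, OF inj(2) j] y by simp
    qed (simp add: transport_unmatched)
    then show ?thesis by simp
  qed
  have ff: "?f' (?f x) = x" if "x \<in> ?V I" for x
    using that unm by (intro transport_transport[OF inj]) auto
  have ff': "?f (?f' y) = y" if "y \<in> ?V I'" for y
    using that unm' by (intro transport_transport[OF inj(2,1)]) auto
  have YV: "x \<in> Y \<longleftrightarrow> x \<in> ?V I \<and> x \<in> orthant ?m" "x \<in> Y' \<longleftrightarrow> x \<in> ?V I' \<and> x \<in> orthant ?m" for x
    by (auto simp: I(2) I'(2) coord_face_def)
  have int_lattice: "transport ?m c c' x \<in> int_lattice ?m"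
    if "x \<in> int_lattice ?m" "inj_on c {..<?m}" for x and c c' :: "nat \<Rightarrow> nat set \<times> nat multiset"
  proof -
    have "transport ?m c c' x j \<in> \<int>" for j
    proof (cases "j \<in> matched ?m c' c")
      case True
      then obtain i where i: "i < ?m" "j < ?m" "c i = c' j" by (rule matchedE)
      then show ?thesis
        using transport_match[of c ?m i j c' x, OF that(2) i] that(1) by (simp add: int_lattice_def)
    qed (simp add: transport_unmatched)
    moreover have "transport ?m c c' x j = 0" if "?m \<le> j" for j
      using that by (intro transport_unmatched) (simp add: matched_def)
    ultimately show ?thesis by (simp add: int_lattice_def topspace_Euclidean_space)
  qed
  have "affine_iso ?f (?V I) (?V I')"
    unfolding affine_iso_def
  proof (intro conjI ballI allI)
    show "bij_betw ?f (?V I) (?V I')"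
    proof (rule bij_betw_byWitness[of _ ?f'])
      show "\<forall>x\<in>?V I. ?f' (?f x) = x" by (intro ballI ff)
      show "\<forall>y\<in>?V I'. ?f (?f' y) = y" by (intro ballI ff')
      show "?f ` ?V I \<subseteq> ?V I'" by (intro image_subsetI fV)
      show "?f' ` ?V I' \<subseteq> ?V I" by (intro image_subsetI fV')
    qed
  qed (rule transport_linear)
  moreover have "?f ` Y = Y'"
  proof (intro equalityI subsetI)
    fix y assume "y \<in> Y'"
    then have y: "y \<in> ?V I'" "y \<in> orthant ?m" by (simp_all only: YV)
    have "?f' y \<in> Y" unfolding YV using fV'[OF y(1)] transport_orthant[OF inj(2) y(2)] by (rule conjI)
    then show "y \<in> ?f ` Y" by (rule image_eqI[of y ?f "?f' y", OF ff'[OF y(1), symmetric]])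
  next
    fix y assume "y \<in> ?f ` Y"
    then obtain x where x: "y = ?f x" "x \<in> Y" by (rule imageE)
    then have "x \<in> ?V I" "x \<in> orthant ?m" by (simp_all only: YV)
    then show "y \<in> Y'" unfolding YV x(1) by (intro conjI fV transport_orthant[OF inj(1)])
  qed
  moreover have "H_proj d n \<sigma> (g, x) = H_proj d n \<sigma> (g', ?f x)" if "x \<in> Y" for x
  proof -
    have x: "x \<in> orthant ?m" "\<forall>i. i \<notin> I \<longrightarrow> x i = 0" using that by (simp_all add: YV)
    have fx: "?f x \<in> orthant ?m" by (rule transport_orthant[OF inj(1) x(1)])
    have "\<forall>i. i \<notin> matched ?m ?b ?b' \<longrightarrow> x i = 0" using x(2) unm by blast
    then have "weights ?m ?b x = weights ?m ?b' (?f x)"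
      by (subst weights_eq_iff[OF inj x(1) fx]) simp
    then show ?thesis by (simp add: H_proj_eq_iff[OF n g x(1) g' fx])
  qed
  moreover have "?f ` (?V I \<inter> int_lattice ?m) = ?V I' \<inter> int_lattice ?m"
  proof (intro equalityI subsetI)
    fix y assume y: "y \<in> ?V I' \<inter> int_lattice ?m"
    then have "?f' y \<in> ?V I \<inter> int_lattice ?m"
      by (elim IntE) (intro IntI fV' int_lattice inj(2))
    moreover have "y = ?f (?f' y)" using y by (elim IntE) (rule ff'[symmetric])
    ultimately show "y \<in> ?f ` (?V I \<inter> int_lattice ?m)"
      by (intro image_eqI[of y ?f "?f' y"])
  next
    fix y assume "y \<in> ?f ` (?V I \<inter> int_lattice ?m)"
    then show "y \<in> ?V I' \<inter> int_lattice ?m"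
      by (elim imageE IntE) (simp only:, intro IntI fV int_lattice inj(1))
  qed
  ultimately show ?thesis
    unfolding lattice_equivalent_def H_chart_def
    by (intro exI[of _ ?f]) (simp add: hull)
qed

lemma H_chartsD: "c \<in> H_charts d n \<sigma> i \<Longrightarrow> lattice_equivalent (H_chart d n \<sigma> i) c"
  by (simp add: H_charts_def lattice_equivalence_on_def)

theorem theorem3p11:
  fixes n d :: nat and \<sigma> :: "nat \<Rightarrow> nat multiset"
  assumes "n \<ge> 3" and "d \<ge> 1" and "\<And>i. i < n \<Longrightarrow> integer_partition d (\<sigma> i)"
  shows "polyhedral_complex (H_space d n \<sigma>)
           (H_index d n \<sigma>) (H_cell d n \<sigma>) (H_charts d n \<sigma>)"
  unfolding polyhedral_complex_def
proof (intro conjI ballI allI impI)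
  let ?m = "n - 3"
  have n: "0 < n" using assms by simp
  have indexD: "fst i \<in> acceptable_data d n \<sigma>" "snd i face_of orthant ?m" if "i \<in> H_index d n \<sigma>" for i
    using that by (auto simp: H_index_def)
  have chart: "chart_for (H_space d n \<sigma>) (H_cell d n \<sigma> i) (H_chart d n \<sigma> i)"
    if "i \<in> H_index d n \<sigma>" for i
    using chart_for_H_chart[OF n indexD[OF that]] by simp
  show "closedin (H_space d n \<sigma>) (H_cell d n \<sigma> i)" if "i \<in> H_index d n \<sigma>" for i
    using chart[OF that] by (simp add: chart_for_def)
  show "H_charts d n \<sigma> i \<in> {c. chart_for (H_space d n \<sigma>) (H_cell d n \<sigma> i) c} //
      lattice_equivalence_on (H_space d n \<sigma>) (H_cell d n \<sigma> i)" if "i \<in> H_index d n \<sigma>" for i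
    unfolding H_charts_def using chart[OF that] by (intro quotientI) simp
  show "topspace (H_space d n \<sigma>) = (\<Union>i\<in>H_index d n \<sigma>. H_cell d n \<sigma> i)"
  proof (intro equalityI subsetI)
    fix x assume "x \<in> topspace (H_space d n \<sigma>)"
    then obtain g p where gp: "g \<in> acceptable_data d n \<sigma>" "p \<in> orthant ?m" "x = H_proj d n \<sigma> (g, p)"
      by (auto simp: topspace_H_space topspace_D_space)
    have "(g, orthant ?m) \<in> H_index d n \<sigma>"
      using gp(1) by (simp add: H_index_def face_of_refl convex_orthant)
    moreover have "x \<in> H_cell d n \<sigma> (g, orthant ?m)" using gp by (auto simp: H_cell_eq)
    ultimately show "x \<in> (\<Union>i\<in>H_index d n \<sigma>. H_cell d n \<sigma> i)" by blast
  next
    fix x assume "x \<in> (\<Union>i\<in>H_index d n \<sigma>. H_cell d n \<sigma> i)"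
    then obtain i where i: "i \<in> H_index d n \<sigma>" "x \<in> H_cell d n \<sigma> i" by blast
    then have "closedin (H_space d n \<sigma>) (H_cell d n \<sigma> i)" using chart by (simp add: chart_for_def)
    then show "x \<in> topspace (H_space d n \<sigma>)" using closedin_subset i(2) by blast
  qed
  show "\<exists>k\<in>H_index d n \<sigma>. H_cell d n \<sigma> i \<inter> H_cell d n \<sigma> j = H_cell d n \<sigma> k"
    if ij: "i \<in> H_index d n \<sigma>" "j \<in> H_index d n \<sigma>" for i j
  proof -
    obtain g Y where i: "i = (g, Y)" by (cases i)
    obtain g' Y' where j: "j = (g', Y')" by (cases j)
    have g: "g \<in> acceptable_data d n \<sigma>" "Y face_of orthant ?m"
      and g': "g' \<in> acceptable_data d n \<sigma>" "Y' face_of orthant ?m"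
      using ij by (simp_all add: i j H_index_def)
    show ?thesis
    proof (cases "Y = {} \<or> Y' = {}")
      case True
      \<comment> \<open>The empty face is no \<open>coord_face\<close>, as those contain 0, and is
        therefore treated apart.\<close>
      then have "H_cell d n \<sigma> i \<inter> H_cell d n \<sigma> j = H_cell d n \<sigma> (g, {})"
        by (auto simp: i j H_cell_eq)
      moreover have "(g, {}) \<in> H_index d n \<sigma>" using g(1) by (simp add: H_index_def)
      ultimately show ?thesis by blast
    next
      case False
      obtain I where I: "I \<subseteq> {..<?m}" "Y = coord_face ?m I"
        using face_of_orthantE[OF g(2)] False by blast
      obtain I' where I': "I' \<subseteq> {..<?m}" "Y' = coord_face ?m I'"
        using face_of_orthantE[OF g'(2)] False by blast
      let ?k = "(g, coord_face ?m (match_face (edge_label n g) (edge_label n g') I I'))"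
      have "H_cell d n \<sigma> i \<inter> H_cell d n \<sigma> j = H_cell d n \<sigma> ?k"
        using H_cell_Int_coord_face[OF n g(1) g'(1) I(1) I'(1)] by (simp add: i j I(2) I'(2))
      moreover have "?k \<in> H_index d n \<sigma>" using g(1) coord_face_of by (simp add: H_index_def)
      ultimately show ?thesis by blast
    qed
  qed
  show "\<exists>j\<in>H_index d n \<sigma>. chart_map c ` Y = H_cell d n \<sigma> j"
    if i: "i \<in> H_index d n \<sigma>" and c: "c \<in> H_charts d n \<sigma> i" and Y: "Y face_of chart_dom c" for i c Y
  proof -
    obtain g X where gX: "i = (g, X)" by (cases i)
    have g: "g \<in> acceptable_data d n \<sigma>" "X face_of orthant ?m"
      using i by (simp_all add: gX H_index_def)
    \<comment> \<open>Here \<open>c\<close> is any chart of the class. Its face is moved to the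
      domain of \<open>H_chart\<close>, which is itself a face of the orthant, and a face of a face
      is a face of the orthant.\<close>
    have "convex (chart_dom (H_chart d n \<sigma> i))"
      using g(2) by (simp add: gX H_chart_def face_of_imp_convex)
    from lattice_equivalent_face[OF H_chartsD[OF c] this Y] obtain Z where
      Z: "Z face_of chart_dom (H_chart d n \<sigma> i)" "chart_map (H_chart d n \<sigma> i) ` Z = chart_map c ` Y" .
    have "Z face_of orthant ?m" using Z(1) g(2) by (auto simp: gX H_chart_def intro: face_of_trans)
    then have "(g, Z) \<in> H_index d n \<sigma>" using g(1) by (simp add: H_index_def)
    moreover have "chart_map c ` Y = H_cell d n \<sigma> (g, Z)"
      using Z(2) by (simp add: gX H_chart_def H_cell_eq)
    ultimately show ?thesis by blast
  qed
  show "lattice_equivalent c c'"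
    if ij: "i \<in> H_index d n \<sigma>" "j \<in> H_index d n \<sigma>" and eq: "H_cell d n \<sigma> i = H_cell d n \<sigma> j"
      and c: "c \<in> H_charts d n \<sigma> i" "c' \<in> H_charts d n \<sigma> j" for i j c c'
  proof -
    have "lattice_equivalent (H_chart d n \<sigma> i) (H_chart d n \<sigma> j)"
      using lattice_equivalent_H_chart[OF n indexD(1)[OF ij(1)] indexD(1)[OF ij(2)]
          indexD(2)[OF ij(1)] indexD(2)[OF ij(2)]] eq by simp
    then show ?thesis
      using H_chartsD[OF c(1)] H_chartsD[OF c(2)] lattice_equivalent_sym lattice_equivalent_trans
      by blast
  qed
qed

end
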